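(* Let $r_1,r_2>0$ and let $B_t$ be a planar Brownian motion started at $1$. Let $\tau_{r_1,r_2}=\inf\{t:\arg(B_t)=r_1\pi\text{ or }\arg(B_t)=-r_2\pi\}$, where $\arg(B_t)$ is the continuous determination of the argument along the path with $\arg(B_0)=0$. Let $\theta=\frac\pi2\big(\frac{r_2-r_1}{r_2+r_1}\big)$ and define, for $y>0$, $$p_+(y)=\frac{\cos\theta}{\pi(r_1+r_2)\,y^{1-\frac1{r_1+r_2}}\big(\cos^2\theta+(y^{\frac1{r_1+r_2}}-\sin\theta)^2\big)},\qquad p_-(y)=\frac{\cos\theta}{\pi(r_1+r_2)\,y^{1-\frac1{r_1+r_2}}\big(\cos^2\theta+(-y^{\frac1{r_1+r_2}}-\sin\theta)^2\big)}.$$ If $e^{r_1\pi i}\ne e^{-r_2\pi i}$, then the density of $B_{\tau_{r_1,r_2}}$ with respect to arclength is $p_+(y)$ at the point $ye^{r_1\pi i}$ and $p_-(y)$ at the point $ye^{-r_2\pi i}$, for $y>0$. If $e^{r_1\pi i}=e^{-r_2\pi i}$, then the density of $B_{\tau_{r_1,r_2}}$ with respect to arclength at the point $ye^{r_1\pi i}$ is $p_+(y)+p_-(y)$, for $y>0$.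
   Context: Planar Brownian motion started at $1$ almost surely never hits $0$, so the continuous argument along the path is well defined almost surely. The density is that of the law of $B_{\tau_{r_1,r_2}}$ with respect to arclength on the ray(s) from the origin through $e^{r_1\pi i}$ and $e^{-r_2\pi i}$. *)

theory Defs
  imports "HOL-Probability.Probability"
begin

text \<open>
  The start point and the continuity of paths are only required almost surely, and
  increments are independent with respect to the filtration generated by the process.
  Only times \<open>t \<ge> 0\<close> matter.
\<close>

locale planar_brownian_motion = prob_space M for M :: "'w measure" +
  fixes B :: "real \<Rightarrow> 'w \<Rightarrow> complex" and z :: complex
  assumes measurable_B: "\<And>t. 0 \<le> t \<Longrightarrow> B t \<in> borel_measurable M"
    and start: "AE \<omega> in M. B 0 \<omega> = z"
    and continuous_paths: "AE \<omega> in M. continuous_on {0..} (\<lambda>t. B t \<omega>)"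
    and indep_increments:
      "\<And>(n::nat) t. 0 \<le> t 0 \<Longrightarrow> (\<And>i. i < n \<Longrightarrow> t i \<le> t (Suc i)) \<Longrightarrow>
        indep_vars (\<lambda>_. borel) (\<lambda>i \<omega>. B (t (Suc i)) \<omega> - B (t i) \<omega>) {..<n}"
    and normal_increments:
      "\<And>s t. 0 \<le> s \<Longrightarrow> s < t \<Longrightarrow>
        distributed M lborel (\<lambda>\<omega>. B t \<omega> - B s \<omega>)
          (\<lambda>w. ennreal (normal_density 0 (sqrt (t - s)) (Re w) *
                        normal_density 0 (sqrt (t - s)) (Im w)))"

definition continuous_arg_of :: "(real \<Rightarrow> complex) \<Rightarrow> (real \<Rightarrow> real) \<Rightarrow> bool" where
  "continuous_arg_of \<gamma> \<phi> \<longleftrightarrow>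
     continuous_on {0..} \<phi> \<and> \<phi> 0 = 0 \<and> (\<forall>t\<ge>0. \<gamma> t \<noteq> 0 \<and> is_Arg (\<gamma> t) (\<phi> t))"

text \<open>
  For a continuous path from \<open>1\<close> that avoids \<open>0\<close> the continuous argument is unique on
  \<open>t \<ge> 0\<close>; for any other path \<open>path_arg\<close> carries no information.
\<close>

definition path_arg :: "(real \<Rightarrow> complex) \<Rightarrow> real \<Rightarrow> real" where
  "path_arg \<gamma> = (SOME \<phi>. continuous_arg_of \<gamma> \<phi>)"

definition wedge_exit_time :: "real \<Rightarrow> real \<Rightarrow> (real \<Rightarrow> complex) \<Rightarrow> ereal" where
  "wedge_exit_time r1 r2 \<gamma> =
     Inf (ereal ` {t. 0 \<le> t \<and> (path_arg \<gamma> t = r1 * pi \<or> path_arg \<gamma> t = - r2 * pi)})"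

text \<open>If the exit time is infinite, the following is the junk value \<open>\<gamma> 0\<close>.\<close>

definition wedge_exit_point :: "real \<Rightarrow> real \<Rightarrow> (real \<Rightarrow> complex) \<Rightarrow> complex" where
  "wedge_exit_point r1 r2 \<gamma> = \<gamma> (real_of_ereal (wedge_exit_time r1 r2 \<gamma>))"

text \<open>
  Arclength on the union of the open rays from \<open>0\<close> in the directions of a finite set \<open>U\<close>
  of unit vectors, as a Borel measure on the plane: the image of counting measure on \<open>U\<close>
  times Lebesgue measure on \<open>(0, \<infinity>)\<close> under the (injective) unit-speed parametrization of
  the rays.  As \<open>U\<close> is a set, coinciding rays are counted once.
\<close>

definition ray_arclength :: "complex set \<Rightarrow> complex measure" where
  "ray_arclength U =
     distr (count_space U \<Otimes>\<^sub>M restrict_space lborel {0<..}) borel (\<lambda>(u, y::real). y *\<^sub>R u)"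

definition exit_theta :: "real \<Rightarrow> real \<Rightarrow> real" where
  "exit_theta r1 r2 = pi / 2 * ((r2 - r1) / (r2 + r1))"

definition p_plus :: "real \<Rightarrow> real \<Rightarrow> real \<Rightarrow> real" where
  "p_plus r1 r2 y =
     (let \<theta> = exit_theta r1 r2 in
      cos \<theta> / (pi * (r1 + r2) * y powr (1 - 1 / (r1 + r2)) *
        ((cos \<theta>)\<^sup>2 + (y powr (1 / (r1 + r2)) - sin \<theta>)\<^sup>2)))"

definition p_minus :: "real \<Rightarrow> real \<Rightarrow> real \<Rightarrow> real" where
  "p_minus r1 r2 y =
     (let \<theta> = exit_theta r1 r2 in
      cos \<theta> / (pi * (r1 + r2) * y powr (1 - 1 / (r1 + r2)) *
        ((cos \<theta>)\<^sup>2 + (- (y powr (1 / (r1 + r2))) - sin \<theta>)\<^sup>2)))"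

end

theory Submission imports Defs "HOL-Complex_Analysis.Complex_Analysis" begin

text \<open>
  The problem becomes planar potential theory in the logarithmic coordinate. A path from \<open>1\<close>
  that avoids \<open>0\<close> has a continuous logarithm \<open>L\<close> with \<open>L 0 = 0\<close>, and \<open>Im L\<close> is its continuous
  argument. The wedge, which may wind around \<open>0\<close> several times, turns into the strip
  \<open>- r2 * pi < Im Y < r1 * pi\<close>, and the exit point is \<open>exp (L \<tau>)\<close> for the first exit time \<open>\<tau>\<close> of \<open>L\<close>
  from this strip. If \<open>h\<close> is harmonic in the strip, bounded, and continuous up to the boundary,
  then \<open>E (h (L \<tau>)) = h 0\<close>. The map \<open>exp (pi / (\<beta> - \<alpha>) * (Y - \<i> * \<alpha>))\<close> takes the strip
  \<open>\<alpha> < Im Y < \<beta>\<close> to the upper half plane. Taking for \<open>h\<close> the harmonic measures of half lines there,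
  smoothed by a vertical shift that is removed in the limit, the identity gives the distribution
  function of the exit point in the half-plane coordinate, an arctangent (\<open>exit_log_tails\<close>). One boundary
  half line of the half plane corresponds to each ray, so differentiating the tails along the two
  rays gives the densities (\<open>exit_law\<close>).

  The stopping identity is proved by discretization instead of stochastic calculus. Sample the path at the
  times \<open>k * T / n\<close> and let a walk in the logarithmic coordinate follow the increments as long as it
  is in a given set \<open>A\<close>, disregarding increments that are not small. An increment of Brownian
  motion has a rotation invariant law, and \<open>h\<close> is the real part of a holomorphic function, which
  as a function of the increment has the mean value property on circles; so every step of the walk
  preserves the expectation of \<open>h\<close> exactly (\<open>expectation_log_walk\<close>). Along a fixed continuous path
  no increment is disregarded once the grid is fine, and for closed \<open>A\<close> the stopped walk converges
  to the value of \<open>L\<close> at its exit from \<open>A\<close> (\<open>log_walk_tendsto\<close>). Exhausting the strip by closed boxes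
  yields the identity for the strip up to a finite time (\<open>stopped_log_harmonic\<close>).

  Two almost sure facts make \<open>\<tau>\<close> meaningful, and both come from the same walk. The harmonic function
  \<open>Re L = ln \<bar>B\<bar>\<close> on annuli shows that \<open>0\<close> is never hit (\<open>AE_never_zero\<close>). A bounded
  harmonic function that is nearly \<open>1\<close> at the start and nearly \<open>0\<close> far away shows
  that \<open>B\<close> stopped at the exit is tight, whereas \<open>B\<close> itself leaves every disc with probability tending to
  \<open>1\<close>; hence the strip is left in finite time (\<open>AE_exits_strip\<close>).
\<close>

section \<open>Rotation invariance and the mean value property\<close>

lemma lborel_complex_eq: "(lborel :: complex measure) = distr (lborel \<Otimes>\<^sub>M lborel) borel (\<lambda>(x, y). Complex x y)"
proof (rule lborel_eqI)
  have [measurable]: "(\<lambda>(x, y). Complex x y) \<in> borel_measurable (lborel \<Otimes>\<^sub>M lborel)"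
    unfolding Complex_eq by measurable
  fix l u :: complex
  assume *: "\<And>b. b \<in> Basis \<Longrightarrow> l \<bullet> b \<le> u \<bullet> b"
  have le: "Re l \<le> Re u" "Im l \<le> Im u"
    using *[of 1] *[of \<i>] by (auto simp: Basis_complex_def)
  have eq: "(\<lambda>(x, y). Complex x y) -` box l u \<inter> space (lborel \<Otimes>\<^sub>M lborel)
     = {Re l<..<Re u} \<times> {Im l<..<Im u}"
    by (auto simp: box_def Basis_complex_def space_pair_measure)
  show "emeasure (distr (lborel \<Otimes>\<^sub>M lborel) borel (\<lambda>(x, y). Complex x y)) (box l u) =
        ennreal (\<Prod>b\<in>Basis. (u - l) \<bullet> b)"
    using le by (simp add: emeasure_distr eq lborel.emeasure_pair_measure_Times Basis_complex_def ennreal_mult)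
qed auto

lemma nn_integral_lborel_complex:
  assumes [measurable]: "f \<in> borel_measurable borel"
  shows "(\<integral>\<^sup>+z. f z \<partial>lborel) = (\<integral>\<^sup>+y. \<integral>\<^sup>+x. f (Complex x y) \<partial>lborel \<partial>lborel)"
    and "(\<integral>\<^sup>+z. f z \<partial>lborel) = (\<integral>\<^sup>+x. \<integral>\<^sup>+y. f (Complex x y) \<partial>lborel \<partial>lborel)"
proof -
  have [measurable]: "(\<lambda>p. Complex (fst p) (snd p)) \<in> borel_measurable (lborel \<Otimes>\<^sub>M lborel)"
    unfolding Complex_eq by measurable
  have "(\<integral>\<^sup>+z. f z \<partial>lborel) = (\<integral>\<^sup>+p. f (Complex (fst p) (snd p)) \<partial>(lborel \<Otimes>\<^sub>M lborel))"
    by (subst lborel_complex_eq, subst nn_integral_distr) (auto simp: case_prod_beta')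
  also have "\<dots> = (\<integral>\<^sup>+y. \<integral>\<^sup>+x. f (Complex x y) \<partial>lborel \<partial>lborel)"
    by (subst lborel_pair.nn_integral_snd[symmetric]) (auto)
  finally show "(\<integral>\<^sup>+z. f z \<partial>lborel) = (\<integral>\<^sup>+y. \<integral>\<^sup>+x. f (Complex x y) \<partial>lborel \<partial>lborel)" .
  also have "\<dots> = (\<integral>\<^sup>+x. \<integral>\<^sup>+y. f (Complex x y) \<partial>lborel \<partial>lborel)"
    by (subst lborel_pair.Fubini'[of "\<lambda>x y. f (Complex x y)"]) (auto simp: case_prod_beta')
  finally show "(\<integral>\<^sup>+z. f z \<partial>lborel) = (\<integral>\<^sup>+x. \<integral>\<^sup>+y. f (Complex x y) \<partial>lborel \<partial>lborel)" .
qed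

lemma nn_integral_lborel_shear:
  fixes a :: real
  assumes [measurable]: "f \<in> borel_measurable borel"
  shows "(\<integral>\<^sup>+z. f (z + of_real (a * Im z)) \<partial>lborel) = (\<integral>\<^sup>+z. f z \<partial>lborel)"
    and "(\<integral>\<^sup>+z. f (z + \<i> * of_real (a * Re z)) \<partial>lborel) = (\<integral>\<^sup>+z. f z \<partial>lborel)"
proof -
  have [measurable]: "(\<lambda>x. Complex x y) \<in> borel_measurable borel" "(\<lambda>x. Complex y x) \<in> borel_measurable borel" for y
    unfolding Complex_eq by measurable
  have "(\<integral>\<^sup>+x. f (Complex x y) \<partial>lborel) = (\<integral>\<^sup>+x. f (Complex (x + a * y) y) \<partial>lborel)" for y
    by (subst nn_integral_real_affine[of _ 1 "a * y"]) (auto simp: add.commute)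
  thus "(\<integral>\<^sup>+z. f (z + of_real (a * Im z)) \<partial>lborel) = (\<integral>\<^sup>+z. f z \<partial>lborel)"
    by (simp add: nn_integral_lborel_complex(1) Complex_eq algebra_simps)
  have "(\<integral>\<^sup>+x. f (Complex y x) \<partial>lborel) = (\<integral>\<^sup>+x. f (Complex y (x + a * y)) \<partial>lborel)" for y
    by (subst nn_integral_real_affine[of _ 1 "a * y"]) (auto simp: add.commute)
  thus "(\<integral>\<^sup>+z. f (z + \<i> * of_real (a * Re z)) \<partial>lborel) = (\<integral>\<^sup>+z. f z \<partial>lborel)"
    by (simp add: nn_integral_lborel_complex(2) Complex_eq algebra_simps)
qed

text \<open>
  A rotation is a composition of three shears parallel to the axes, and a shear preserves Lebesgue
  measure by Fubini and translation invariance of the line.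
\<close>

lemma nn_integral_lborel_rotate:
  fixes u :: complex
  assumes [measurable]: "f \<in> borel_measurable borel" and u: "norm u = 1"
  shows "(\<integral>\<^sup>+z. f (u * z) \<partial>lborel) = (\<integral>\<^sup>+z. f z \<partial>lborel)"
proof -
  have rot: "(\<integral>\<^sup>+z. g (v * z) \<partial>lborel) = (\<integral>\<^sup>+z. g z \<partial>lborel)"
    if [measurable]: "g \<in> borel_measurable borel" and v: "norm v = 1" "Im v \<noteq> 0" for g and v :: complex
  proof -
    \<comment> \<open>the factorization of a rotation into shears needs \<open>sin \<noteq> 0\<close>; the half turn is done as two quarter turns\<close>
    define c s a where "c = Re v" and "s = Im v" and "a = (c - 1) / s"
    have s: "s \<noteq> 0" and cs: "c\<^sup>2 + s\<^sup>2 = 1" using v by (auto simp: s_def c_def cmod_def)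
    have as0: "a * s = c - 1" using s by (simp add: a_def)
    have "(a + a * c) * s = a * s * (1 + c)" by (simp add: algebra_simps)
    also have "\<dots> = - s * s" unfolding as0 using cs by (simp add: power2_eq_square algebra_simps)
    finally have "a + a * c = - s" by (rule mult_right_cancel[OF s, THEN iffD1])
    hence as: "1 + a * s = c" "a + a * c = - s" using as0 by simp_all
    define S T where "S z = z + of_real (a * Im z)" and "T z = z + \<i> * of_real (s * Re z)" for z :: complex
    have [measurable]: "S \<in> borel_measurable borel" "T \<in> borel_measurable borel"
      unfolding S_def T_def by measurable
    have "v * z = S (T (S z))" for z
    proof (rule complex_eqI)
      have "Re (S (T (S z))) = (1 + a * s) * Re z + (a + a * (1 + a * s)) * Im z"
        by (simp add: S_def T_def algebra_simps)
      thus "Re (v * z) = Re (S (T (S z)))" unfolding as by (simp add: c_def s_def)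
      have "Im (S (T (S z))) = (1 + a * s) * Im z + s * Re z"
        by (simp add: S_def T_def algebra_simps)
      thus "Im (v * z) = Im (S (T (S z)))" unfolding as by (simp add: c_def s_def)
    qed
    hence "(\<integral>\<^sup>+z. g (v * z) \<partial>lborel) = (\<integral>\<^sup>+z. g (S (T (S z))) \<partial>lborel)" by simp
    also have "\<dots> = (\<integral>\<^sup>+z. g (S (T z)) \<partial>lborel)"
      by (rule nn_integral_lborel_shear(1)[of "\<lambda>z. g (S (T z))" a, folded S_def]) measurable
    also have "\<dots> = (\<integral>\<^sup>+z. g (S z) \<partial>lborel)"
      by (rule nn_integral_lborel_shear(2)[of "\<lambda>z. g (S z)" s, folded T_def]) measurable
    also have "\<dots> = (\<integral>\<^sup>+z. g z \<partial>lborel)"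
      by (rule nn_integral_lborel_shear(1)[of g a, folded S_def]) measurable
    finally show ?thesis .
  qed
  show ?thesis
  proof (cases "Im u = 0")
    case True
    hence "u = 1 \<or> u = -1" using u by (auto simp: cmod_def complex_eq_iff)
    thus ?thesis
    proof
      assume "u = -1"
      thus ?thesis using rot[of "\<lambda>z. f (\<i> * z)" \<i>] rot[of f \<i>] by (simp add: mult.assoc[symmetric])
    qed simp
  qed (use rot[OF assms] in simp)
qed

lemma circle_mean_value:
  assumes f: "f holomorphic_on ball z r" and y: "norm y < r"
  shows "((\<lambda>t. f (z + cis (2 * pi * t) * y)) has_integral f z) {0..1::real}"
proof (cases "y = 0")
  case True
  thus ?thesis using has_integral_const_real[of "f z" 0 1] by simp
next
  case False
  define \<rho> where "\<rho> = norm y"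
  define u where "u = y / of_real \<rho>"
  have \<rho>: "\<rho> > 0" "\<rho> < r" and u: "norm u = 1" and y_eq: "y = u * of_real \<rho>"
    using False y by (auto simp: \<rho>_def u_def norm_divide)
  have "(\<lambda>\<xi>. z + u * \<xi>) ` cball 0 \<rho> \<subseteq> ball z r"
    using u \<rho> by (auto simp: dist_norm norm_mult)
  hence "(f \<circ> (\<lambda>\<xi>. z + u * \<xi>)) holomorphic_on cball 0 \<rho>"
    by (intro holomorphic_on_compose_gen[OF _ f] holomorphic_intros) auto
  hence "((\<lambda>\<xi>. f (z + u * \<xi>) / (\<xi> - 0)) has_contour_integral (2 * of_real pi * \<i> * f (z + u * 0))) (circlepath 0 \<rho>)"
    using \<rho> by (intro Cauchy_integral_circlepath_simple) (auto simp: o_def)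
  hence "((\<lambda>t. 2 * of_real pi * \<i> * f (z + cis (2 * pi * t) * y)) has_integral (2 * of_real pi * \<i> * f z)) {0..1}"
    unfolding has_contour_integral_def
  proof (rule has_integral_eq_rhs[OF has_integral_eq[rotated]])
    fix t :: real
    assume t: "t \<in> {0..1}"
    have *: "circlepath 0 \<rho> t = of_real \<rho> * cis (2 * pi * t)"
      by (simp add: circlepath cis_conv_exp mult_ac)
    have **: "vector_derivative (circlepath 0 \<rho>) (at t within {0..1}) = 2 * of_real pi * \<i> * circlepath 0 \<rho> t"
      using t by (simp add: vector_derivative_circlepath01) (simp add: circlepath mult_ac)
    show "f (z + u * circlepath 0 \<rho> t) / (circlepath 0 \<rho> t - 0) * vector_derivative (circlepath 0 \<rho>) (at t within {0..1})
        = 2 * of_real pi * \<i> * f (z + cis (2 * pi * t) * y)"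
      unfolding ** unfolding * using \<rho> by (simp add: y_eq mult_ac)
  qed simp
  from has_integral_mult_right[OF this, of "1 / (2 * of_real pi * \<i>)"]
  show ?thesis by (simp add: mult.assoc[symmetric])
qed

text \<open>
  Averaging the integral over all rotations and exchanging the order of integration replaces \<open>k\<close> by its
  circle means. Polar coordinates are avoided this way.
\<close>

lemma integral_rotation_invariant:
  fixes \<nu> :: "complex measure" and k :: "complex \<Rightarrow> real"
  assumes "prob_space \<nu>" and sets[measurable_cong]: "sets \<nu> = sets borel"
    and inv: "\<And>u. norm u = 1 \<Longrightarrow> distr \<nu> borel (\<lambda>z. u * z) = \<nu>"
    and [measurable]: "k \<in> borel_measurable borel" and bound: "\<And>y. \<bar>k y\<bar> \<le> C"
    and mean: "\<And>y. ((\<lambda>t. k (cis (2 * pi * t) * y)) has_integral c) {0..1::real}"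
  shows "integral\<^sup>L \<nu> k = c"
proof -
  interpret \<nu>: prob_space \<nu> by fact
  define U where "U = restrict_space lborel {0..1::real}"
  interpret U: prob_space U
    by (rule prob_spaceI) (simp add: U_def emeasure_restrict_space space_restrict_space)
  interpret pair_prob_space U \<nu> ..
  have [measurable_cong]: "sets U = sets (restrict_space borel {0..1})"
    unfolding U_def by (rule sets_restrict_space_cong) simp
  have [measurable]: "cis \<in> borel_measurable borel"
    by (intro borel_measurable_continuous_onI continuous_intros)
  have [measurable]: "(\<lambda>t. cis (2 * pi * t)) \<in> borel_measurable U"
    unfolding U_def by (intro measurable_restrict_space1) measurable
  have [measurable]: "(\<lambda>y. y) \<in> borel_measurable \<nu>"
    by (rule measurable_ident_sets[OF sets])
  have int: "integrable (U \<Otimes>\<^sub>M \<nu>) (\<lambda>(t, y). k (cis (2 * pi * t) * y))"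
    by (rule P.integrable_const_bound[of _ C]) (auto simp: bound)
  have "integral\<^sup>L \<nu> k = (\<integral>y. k (cis (2 * pi * t) * y) \<partial>\<nu>)" for t
    by (subst inv[of "cis (2 * pi * t)", symmetric], simp, subst integral_distr) auto
  hence "integral\<^sup>L \<nu> k = (\<integral>t. (\<integral>y. k (cis (2 * pi * t) * y) \<partial>\<nu>) \<partial>U)"
    by (simp add: U.prob_space)
  also have "\<dots> = (\<integral>y. (\<integral>t. k (cis (2 * pi * t) * y) \<partial>U) \<partial>\<nu>)"
    using Fubini_integral[OF int] by simp
  also have "\<dots> = (\<integral>y. c \<partial>\<nu>)"
  proof (intro Bochner_Integration.integral_cong refl)
    fix y
    have m: "(\<lambda>t. k (cis (2 * pi * t) * y)) \<in> borel_measurable borel" by measurable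
    have "set_integrable lborel {0..1} (\<lambda>t. k (cis (2 * pi * t) * y))"
      unfolding set_integrable_def
      by (rule integrableI_bounded_set_indicator[where B=C])
         (use m in \<open>auto simp: bound\<close>)
    hence "(LINT t:{0..1}|lborel. k (cis (2 * pi * t) * y)) = integral {0..1} (\<lambda>t. k (cis (2 * pi * t) * y))"
      by (rule set_borel_integral_eq_integral)
    also have "\<dots> = c" using mean[of y] by (rule integral_unique)
    finally show "(\<integral>t. k (cis (2 * pi * t) * y) \<partial>U) = c"
      unfolding U_def by (simp add: integral_restrict_space set_lebesgue_integral_def)
  qed
  also have "\<dots> = c" by (simp add: \<nu>.prob_space)
  finally show ?thesis .
qed

section \<open>A walk in the logarithmic coordinate that preserves harmonic functions\<close>

definition planar_gaussian :: "real \<Rightarrow> complex measure" where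
  "planar_gaussian \<sigma> = density lborel
     (\<lambda>w. ennreal (normal_density 0 \<sigma> (Re w) * normal_density 0 \<sigma> (Im w)))"

lemma sets_planar_gaussian [simp, measurable_cong]: "sets (planar_gaussian \<sigma>) = sets borel"
  by (simp add: planar_gaussian_def)

lemma planar_gaussian_density_rotate:
  assumes "norm u = 1"
  shows "normal_density 0 \<sigma> (Re (u * w)) * normal_density 0 \<sigma> (Im (u * w)) =
         normal_density 0 \<sigma> (Re w) * normal_density 0 \<sigma> (Im w)"
proof -
  have *: "normal_density 0 \<sigma> (Re v) * normal_density 0 \<sigma> (Im v) =
     (1 / sqrt (2 * pi * \<sigma>\<^sup>2))\<^sup>2 * exp (- ((norm v)\<^sup>2 / (2 * \<sigma>\<^sup>2)))" for v
    unfolding normal_density_def cmod_power2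
    by (simp add: power2_eq_square add_divide_distrib exp_add[symmetric] mult_ac)
  show ?thesis unfolding * using assms by (simp add: norm_mult)
qed

lemma planar_gaussian_rotate:
  assumes u: "norm u = 1"
  shows "distr (planar_gaussian \<sigma>) borel (\<lambda>z. u * z) = planar_gaussian \<sigma>"
proof (rule measure_eqI)
  fix A assume "A \<in> sets (distr (planar_gaussian \<sigma>) borel (\<lambda>z. u * z))"
  hence [measurable]: "A \<in> sets borel" by simp
  have [measurable]: "(\<lambda>z. u * z) -` A \<in> sets borel"
    using measurable_sets[of "\<lambda>z. u * z" borel borel A] by simp
  let ?g = "\<lambda>w. ennreal (normal_density 0 \<sigma> (Re w) * normal_density 0 \<sigma> (Im w))"
  have "emeasure (distr (planar_gaussian \<sigma>) borel (\<lambda>z. u * z)) A =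
      (\<integral>\<^sup>+w. ?g w * indicator ((\<lambda>z. u * z) -` A) w \<partial>lborel)"
    by (subst emeasure_distr) (auto simp: planar_gaussian_def emeasure_density)
  also have "\<dots> = (\<integral>\<^sup>+w. ?g (u * w) * indicator A (u * w) \<partial>lborel)"
    by (intro nn_integral_cong) (simp only: planar_gaussian_density_rotate[OF u], simp add: indicator_def)
  also have "\<dots> = (\<integral>\<^sup>+w. ?g w * indicator A w \<partial>lborel)"
    by (rule nn_integral_lborel_rotate[OF _ u]) measurable
  also have "\<dots> = emeasure (planar_gaussian \<sigma>) A"
    by (simp add: planar_gaussian_def emeasure_density)
  finally show "emeasure (distr (planar_gaussian \<sigma>) borel (\<lambda>z. u * z)) A = emeasure (planar_gaussian \<sigma>) A" .
qed simp

text \<open>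
  If \<open>Y\<close> is a logarithm of the position \<open>z\<close>, then a step with a small increment \<open>y\<close> leads to the
  logarithm of \<open>z + y\<close> that is close to \<open>Y\<close>. The walk stands still outside \<open>A\<close>, which builds the
  stopping into the dynamics. Disregarding large increments keeps the principal logarithm on the right
  branch, and does so by a rotation invariant condition.
\<close>

definition log_step :: "complex set \<Rightarrow> real \<Rightarrow> complex \<Rightarrow> complex \<Rightarrow> complex" where
  "log_step A r Y y = (if Y \<in> A \<and> norm y < r then Y + Ln (1 + y / exp Y) else Y)"

primrec log_walk :: "complex set \<Rightarrow> real \<Rightarrow> (nat \<Rightarrow> complex) \<Rightarrow> nat \<Rightarrow> complex" where
  "log_walk A r x 0 = 0"
| "log_walk A r x (Suc k) = log_step A r (log_walk A r x k) (x k)"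

lemma log_walk_cong:
  "(\<And>i. i < k \<Longrightarrow> x i = y i) \<Longrightarrow> log_walk A r x k = log_walk A r y k"
  by (induction k) auto

lemma measurable_log_step [measurable (raw)]:
  assumes [measurable]: "A \<in> sets borel" "f \<in> borel_measurable M" "g \<in> borel_measurable M"
  shows "(\<lambda>x. log_step A r (f x) (g x)) \<in> borel_measurable M"
proof -
  have [measurable]: "exp \<in> borel_measurable (borel :: complex measure)"
    by (intro borel_measurable_continuous_onI continuous_intros)
  show ?thesis unfolding log_step_def by measurable
qed

lemma measurable_log_walk:
  assumes [measurable]: "A \<in> sets borel" and "\<And>i. i < k \<Longrightarrow> (\<lambda>\<omega>. X i \<omega>) \<in> borel_measurable M"
  shows "(\<lambda>\<omega>. log_walk A r (\<lambda>i. X i \<omega>) k) \<in> borel_measurable M"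
  using assms(2) by (induction k) (auto intro!: measurable_log_step assms(1))

text \<open>
  The set \<open>D\<close> contains everything that is reachable by one step from \<open>A\<close>; harmonicity is needed on \<open>D\<close> and
  not only on \<open>A\<close>, since a step takes a mean over a disc around a point of \<open>A\<close>.
\<close>

locale log_walk_domain =
  fixes A :: "complex set" and r :: real and D :: "complex set"
  assumes A_borel [measurable]: "A \<in> sets borel"
    and r_pos: "0 < r"
    and zero_in_D: "0 \<in> D"
    and small: "\<And>Y (y::complex). Y \<in> A \<Longrightarrow> norm y < r \<Longrightarrow> norm y < norm (exp Y)"
    and step_in_D: "\<And>Y y. Y \<in> A \<Longrightarrow> norm y < r \<Longrightarrow> Y + Ln (1 + y / exp Y) \<in> D"
begin

lemma log_walk_in_D: "log_walk A r x k \<in> D"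
  by (induction k) (auto simp: zero_in_D log_step_def step_in_D)

text \<open>
  As a function of the increment, \<open>G (Y + Ln (1 + y / exp Y))\<close> is holomorphic in the disc of radius \<open>r\<close>
  with value \<open>G Y\<close> at the centre, so its mean over every circle around \<open>0\<close> is \<open>G Y\<close>. Rotation invariance of
  the increment is all that is used about its law.
\<close>

lemma integral_log_step:
  fixes h :: "complex \<Rightarrow> real"
  assumes "prob_space \<nu>" and sets: "sets \<nu> = sets borel"
    and inv: "\<And>u. norm u = 1 \<Longrightarrow> distr \<nu> borel (\<lambda>z. u * z) = \<nu>"
    and G: "G holomorphic_on D"
    and h[measurable]: "h \<in> borel_measurable borel" and hG: "\<And>Y. Y \<in> D \<Longrightarrow> h Y = Re (G Y)"
    and bound: "\<And>Y. Y \<in> D \<Longrightarrow> \<bar>h Y\<bar> \<le> C" and Y: "Y \<in> D"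
  shows "(\<integral>y. h (log_step A r Y y) \<partial>\<nu>) = h Y"
proof (rule integral_rotation_invariant[OF assms(1) sets inv])
  show "(\<lambda>y. h (log_step A r Y y)) \<in> borel_measurable borel" by measurable
  show "\<bar>h (log_step A r Y y)\<bar> \<le> C" for y
    using Y by (intro bound) (auto simp: log_step_def step_in_D)
  fix y
  show "((\<lambda>t. h (log_step A r Y (cis (2 * pi * t) * y))) has_integral h Y) {0..1::real}"
  proof (cases "Y \<in> A \<and> norm y < r")
    case False
    thus ?thesis using has_integral_const_real[of "h Y" 0 1] by (auto simp: log_step_def norm_mult)
  next
    case True
    define F where "F \<xi> = G (Y + Ln (1 + \<xi> / exp Y))" for \<xi>
    have nonpos: "1 + \<xi> / exp Y \<notin> \<real>\<^sub>\<le>\<^sub>0" if "norm \<xi> < r" for \<xi>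
    proof -
      have "norm (\<xi> / exp Y) < 1"
        using small[of Y \<xi>] True that by (simp add: norm_divide)
      hence "Re (1 + \<xi> / exp Y) > 0"
        using abs_Re_le_cmod[of "\<xi> / exp Y"] by simp
      thus ?thesis using complex_nonpos_Reals_iff by force
    qed
    have "(G \<circ> (\<lambda>\<xi>. Y + Ln (1 + \<xi> / exp Y))) holomorphic_on ball 0 r"
      using True nonpos step_in_D
      by (intro holomorphic_on_compose_gen[OF _ G] holomorphic_intros) auto
    hence "F holomorphic_on ball 0 r" by (simp add: F_def[abs_def] o_def)
    from has_integral_Re[OF circle_mean_value[OF this]] True
    have "((\<lambda>t. Re (F (0 + cis (2 * pi * t) * y))) has_integral Re (F 0)) {0..1::real}"
      by auto
    moreover have "Re (F 0) = h Y" using hG Y by (simp add: F_def)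
    moreover have "Re (F (0 + cis (2 * pi * t) * y)) = h (log_step A r Y (cis (2 * pi * t) * y))" for t
      using True step_in_D[of Y "cis (2 * pi * t) * y"]
      by (simp add: F_def log_step_def norm_mult hG)
    ultimately show ?thesis by simp
  qed
qed

text \<open>
  Induction on the number of steps: the last increment is integrated out first, given the others.
\<close>

lemma integral_log_walk_PiM:
  fixes h :: "complex \<Rightarrow> real"
  assumes "prob_space \<nu>" and sets[measurable_cong, simp]: "sets \<nu> = sets borel"
    and inv: "\<And>u. norm u = 1 \<Longrightarrow> distr \<nu> borel (\<lambda>z. u * z) = \<nu>"
    and G: "G holomorphic_on D"
    and h[measurable]: "h \<in> borel_measurable borel" and hG: "\<And>Y. Y \<in> D \<Longrightarrow> h Y = Re (G Y)"
    and bound: "\<And>Y. Y \<in> D \<Longrightarrow> \<bar>h Y\<bar> \<le> C"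
  shows "(\<integral>x. h (log_walk A r x k) \<partial>(\<Pi>\<^sub>M i\<in>{..<k}. \<nu>)) = h 0"
proof (induction k)
  case 0
  show ?case by (simp add: PiM_empty lebesgue_integral_count_space_finite)
next
  case (Suc k)
  interpret \<nu>: prob_space \<nu> by fact
  interpret product_prob_space "\<lambda>_::nat. \<nu>" ..
  interpret PS: prob_space "\<Pi>\<^sub>M i\<in>{..<Suc k}. \<nu>" using assms(1) by (rule prob_space_PiM)
  have m: "(\<lambda>x. log_walk A r x (Suc k)) \<in> borel_measurable (\<Pi>\<^sub>M i\<in>{..<Suc k}. \<nu>)"
    by (rule measurable_log_walk[where X = "\<lambda>i x. x i"])
       (auto simp: measurable_cong_sets[OF refl sets, symmetric] intro!: measurable_component_singleton)
  have "integrable (\<Pi>\<^sub>M i\<in>{..<Suc k}. \<nu>) (\<lambda>x. h (log_walk A r x (Suc k)))"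
    using m by (intro PS.integrable_const_bound[of _ C]) (auto intro!: bound log_walk_in_D simp del: log_walk.simps)
  hence "(\<integral>x. h (log_walk A r x (Suc k)) \<partial>(\<Pi>\<^sub>M i\<in>{..<Suc k}. \<nu>)) =
      (\<integral>x. (\<integral>y. h (log_walk A r (x(k := y)) (Suc k)) \<partial>\<nu>) \<partial>(\<Pi>\<^sub>M i\<in>{..<k}. \<nu>))"
    unfolding lessThan_Suc by (intro product_integral_insert) auto
  also have "\<dots> = (\<integral>x. h (log_walk A r x k) \<partial>(\<Pi>\<^sub>M i\<in>{..<k}. \<nu>))"
  proof (intro Bochner_Integration.integral_cong refl)
    fix x
    have "log_walk A r (x(k := y)) (Suc k) = log_step A r (log_walk A r x k) y" for y
      using log_walk_cong[of k "x(k := y)" x] by simp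
    thus "(\<integral>y. h (log_walk A r (x(k := y)) (Suc k)) \<partial>\<nu>) = h (log_walk A r x k)"
      using integral_log_step[OF assms log_walk_in_D] by simp
  qed
  also have "\<dots> = h 0" by (rule Suc)
  finally show ?case .
qed

end

definition grid_increment :: "(real \<Rightarrow> complex) \<Rightarrow> real \<Rightarrow> nat \<Rightarrow> nat \<Rightarrow> complex" where
  "grid_increment \<gamma> T n k = \<gamma> (real (Suc k) * T / real n) - \<gamma> (real k * T / real n)"

context planar_brownian_motion
begin

lemma measurable_log_walk_grid:
  assumes "A \<in> sets borel" "0 < T"
  shows "(\<lambda>\<omega>. log_walk A r (grid_increment (\<lambda>t. B t \<omega>) T n) n) \<in> borel_measurable M"
  using assms by (intro measurable_log_walk) (auto simp: grid_increment_def intro!: borel_measurable_diff measurable_B)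

lemma expectation_log_walk:
  fixes h :: "complex \<Rightarrow> real"
  assumes "log_walk_domain A r D" and T: "0 < T" and n: "0 < n"
    and G: "G holomorphic_on D"
    and h[measurable]: "h \<in> borel_measurable borel" and hG: "\<And>Y. Y \<in> D \<Longrightarrow> h Y = Re (G Y)"
    and bound: "\<And>Y. Y \<in> D \<Longrightarrow> \<bar>h Y\<bar> \<le> C"
  shows "expectation (\<lambda>\<omega>. h (log_walk A r (grid_increment (\<lambda>t. B t \<omega>) T n) n)) = h 0"
proof -
  interpret log_walk_domain A r D by fact
  define X where "X k \<omega> = grid_increment (\<lambda>t. B t \<omega>) T n k" for k \<omega>
  define \<nu> where "\<nu> = planar_gaussian (sqrt (T / real n))"
  have Xm[measurable]: "X k \<in> borel_measurable M" for k
    unfolding X_def grid_increment_def using T by (intro borel_measurable_diff measurable_B) auto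
  have d: "distr M borel (X k) = \<nu>" for k
  proof -
    have "distributed M lborel (\<lambda>\<omega>. B (real (Suc k) * T / real n) \<omega> - B (real k * T / real n) \<omega>)
          (\<lambda>w. ennreal (normal_density 0 (sqrt (real (Suc k) * T / real n - real k * T / real n)) (Re w) *
                        normal_density 0 (sqrt (real (Suc k) * T / real n - real k * T / real n)) (Im w)))"
      using T n by (intro normal_increments) (auto simp: field_simps)
    hence "distr M lborel (X k) = \<nu>"
      unfolding distributed_def X_def grid_increment_def \<nu>_def planar_gaussian_def
      using n by (simp add: field_simps)
    thus ?thesis by (simp cong: distr_cong)
  qed
  have sets: "sets \<nu> = sets borel" by (simp add: \<nu>_def)
  have \<nu>: "prob_space \<nu>" using prob_space_distr[of "X 0" borel] d by simp
  have "indep_vars (\<lambda>_. borel) (\<lambda>i \<omega>. B (real (Suc i) * T / real n) \<omega> - B (real i * T / real n) \<omega>) {..<n}"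
    using T by (intro indep_increments) (auto simp: divide_right_mono)
  hence "indep_vars (\<lambda>_. borel) X {..<n}"
    by (simp add: X_def[abs_def] grid_increment_def)
  hence "distr M (\<Pi>\<^sub>M i\<in>{..<n}. borel) (\<lambda>\<omega>. \<lambda>i\<in>{..<n}. X i \<omega>) = (\<Pi>\<^sub>M i\<in>{..<n}. distr M borel (X i))"
    using n by (subst (asm) indep_vars_iff_distr_eq_PiM) (auto simp: lessThan_empty_iff)
  hence eq: "distr M (\<Pi>\<^sub>M i\<in>{..<n}. borel) (\<lambda>\<omega>. \<lambda>i\<in>{..<n}. X i \<omega>) = (\<Pi>\<^sub>M i\<in>{..<n}. \<nu>)"
    by (simp add: d)
  have m: "(\<lambda>x. log_walk A r x n) \<in> borel_measurable (\<Pi>\<^sub>M i\<in>{..<n}. borel)"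
    by (rule measurable_log_walk[where X = "\<lambda>i x. x i"])
       (auto intro!: measurable_component_singleton)
  have "h 0 = (\<integral>x. h (log_walk A r x n) \<partial>(\<Pi>\<^sub>M i\<in>{..<n}. \<nu>))"
    by (rule integral_log_walk_PiM[OF \<nu> sets _ G h hG bound, symmetric])
       (auto simp: \<nu>_def planar_gaussian_rotate)
  also have "\<dots> = expectation (\<lambda>\<omega>. h (log_walk A r (\<lambda>i\<in>{..<n}. X i \<omega>) n))"
    unfolding eq[symmetric] using m by (subst integral_distr) auto
  also have "(\<lambda>\<omega>. log_walk A r (\<lambda>i\<in>{..<n}. X i \<omega>) n) =
      (\<lambda>\<omega>. log_walk A r (grid_increment (\<lambda>t. B t \<omega>) T n) n)"
    by (intro ext log_walk_cong) (simp add: X_def)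
  finally show ?thesis by simp
qed

end

section \<open>Convergence of the walk along a continuous path\<close>

lemma eventually_grid_oscillation:
  fixes f :: "real \<Rightarrow> 'a::metric_space"
  assumes cont: "continuous_on {0..} f" and T: "0 < T" and e: "0 < e"
  shows "\<forall>\<^sub>F n in sequentially. \<forall>k<n. dist (f (real (Suc k) * T / real n)) (f (real k * T / real n)) < e"
proof -
  have "uniformly_continuous_on {0..T} f"
    by (intro compact_uniformly_continuous continuous_on_subset[OF cont]) auto
  then obtain d where d: "d > 0"
    "\<And>x y. x \<in> {0..T} \<Longrightarrow> y \<in> {0..T} \<Longrightarrow> dist y x < d \<Longrightarrow> dist (f y) (f x) < e"
    using e unfolding uniformly_continuous_on_def by metis
  have "((\<lambda>n. T / real n) \<longlongrightarrow> 0) sequentially" by real_asymp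
  hence "\<forall>\<^sub>F n in sequentially. T / real n < d" using d(1) by (rule order_tendstoD)
  thus ?thesis
  proof eventually_elim
    case (elim n)
    show ?case
    proof (intro allI impI d(2))
      fix k assume k: "k < n"
      have "real k * T \<le> real n * T" "real (Suc k) * T \<le> real n * T"
        using k T by (intro mult_right_mono; simp)+
      thus "real k * T / real n \<in> {0..T}" "real (Suc k) * T / real n \<in> {0..T}"
        using k T by (auto simp: field_simps)
      have "real (Suc k) * T / real n - real k * T / real n = T / real n"
        using k by (simp add: field_simps)
      moreover have "T / real n \<ge> 0" using T by simp
      ultimately show "dist (real (Suc k) * T / real n) (real k * T / real n) < d"
        using elim by (simp add: dist_real_def)
    qed
  qed
qed

lemma eventually_grid_point_below:
  assumes t: "0 \<le> t" "t \<le> T" and T: "0 < T" and d: "0 < d"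
  shows "\<forall>\<^sub>F n in sequentially. \<exists>k\<le>n. real k * T / real n \<in> {t - d<..t}"
proof -
  have "((\<lambda>n. T / real n) \<longlongrightarrow> 0) sequentially" by real_asymp
  hence "\<forall>\<^sub>F n in sequentially. T / real n < d" using d by (rule order_tendstoD)
  with eventually_gt_at_top[of 0] show ?thesis
  proof eventually_elim
    case (elim n)
    define k where "k = nat \<lfloor>t * real n / T\<rfloor>"
    have k: "real k \<le> t * real n / T" "t * real n / T < real k + 1"
      using t T unfolding k_def by auto
    have kT: "real k * T \<le> t * real n" "t * real n < real k * T + T"
      using k T by (simp_all add: field_simps)
    have "real k * T \<le> real n * T"
      using kT(1) mult_right_mono[of t T "real n"] t by (simp add: mult.commute)
    hence "k \<le> n" using T by simp
    moreover have "real k * T / real n \<le> t" using kT elim by (simp add: field_simps)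
    moreover have "t < real k * T / real n + T / real n" using kT elim by (simp add: field_simps)
    ultimately show ?case using elim by (intro exI[of _ k]) auto
  qed
qed

text \<open>
  The minimum of \<open>T\<close> and the exit time from \<open>A\<close>, without a case distinction for paths that stay in \<open>A\<close>.
\<close>

definition exit_before :: "complex set \<Rightarrow> (real \<Rightarrow> complex) \<Rightarrow> real \<Rightarrow> real" where
  "exit_before A L T = Inf (insert T {t \<in> {0..T}. L t \<notin> A})"

lemma exit_before_bounds:
  assumes "0 \<le> T"
  shows "0 \<le> exit_before A L T" "exit_before A L T \<le> T"
  using assms unfolding exit_before_def
  by (auto intro!: cInf_greatest cInf_lower bdd_belowI[of _ 0])

lemma exit_before_le: "0 \<le> t \<Longrightarrow> t \<le> T \<Longrightarrow> L t \<notin> A \<Longrightarrow> exit_before A L T \<le> t"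
  unfolding exit_before_def by (auto intro!: cInf_lower bdd_belowI[of _ 0])

lemma in_before_exit_before:
  assumes "0 \<le> T" "0 \<le> t" "t < exit_before A L T"
  shows "L t \<in> A"
  using exit_before_le[of t T L A] exit_before_bounds(2)[of T A L] assms by force

lemma exit_before_less:
  assumes "exit_before A L T < u"
  obtains t where "t < u" "t = T \<or> t \<in> {0..T} \<and> L t \<notin> A"
  using assms unfolding exit_before_def
  by (subst (asm) cInf_less_iff) (auto intro!: bdd_belowI[of _ 0])

lemma exit_before_mono:
  assumes "A \<subseteq> A'" "0 \<le> T"
  shows "exit_before A L T \<le> exit_before A' L T"
  unfolding exit_before_def
  by (rule cInf_superset_mono) (use assms in \<open>auto intro!: bdd_belowI[of _ 0]\<close>)

lemma log_walk_stopped: "log_walk A r x k \<notin> A \<Longrightarrow> k \<le> n \<Longrightarrow> log_walk A r x n = log_walk A r x k"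
proof (induction n)
  case (Suc n)
  thus ?case by (cases "k = Suc n") (auto simp: log_step_def)
qed auto

lemma (in log_walk_domain) exp_log_step:
  assumes "Y \<in> A" "norm y < r"
  shows "exp (log_step A r Y y) = exp Y + y"
proof -
  have "1 + y / exp Y \<noteq> 0"
  proof
    assume "1 + y / exp Y = 0"
    hence "y = - exp Y" by (simp add: field_simps add_eq_0_iff)
    thus False using small[OF assms] by simp
  qed
  thus ?thesis using assms by (simp add: log_step_def exp_add field_simps)
qed

lemma (in log_walk_domain) exp_log_walk:
  assumes "\<gamma> 0 = 1" "\<And>i. i < n \<Longrightarrow> norm (grid_increment \<gamma> T n i) < r"
    and "k \<le> n" "\<And>j. j < k \<Longrightarrow> log_walk A r (grid_increment \<gamma> T n) j \<in> A"
  shows "exp (log_walk A r (grid_increment \<gamma> T n) k) = \<gamma> (real k * T / real n)"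
  using assms(3,4)
proof (induction k)
  case (Suc k)
  thus ?case using assms(2)[of k] by (simp add: exp_log_step grid_increment_def)
qed (simp add: assms)

lemma (in log_walk_domain) log_walk_eq_log_path:
  assumes L: "L 0 = 0" "\<And>t. 0 \<le> t \<Longrightarrow> exp (L t) = \<gamma> t" and T: "0 < T"
    and incr: "\<And>i. i < n \<Longrightarrow> norm (grid_increment \<gamma> T n i) < r"
    and osc: "\<And>i. i < n \<Longrightarrow> dist (L (real (Suc i) * T / real n)) (L (real i * T / real n)) < pi"
    and "k \<le> n" "\<And>j. j < k \<Longrightarrow> L (real j * T / real n) \<in> A"
  shows "log_walk A r (grid_increment \<gamma> T n) k = L (real k * T / real n)"
  using assms(6,7)
proof (induction k)
  case (Suc k)
  define t u where "t = real k * T / real n" and "u = real (Suc k) * T / real n"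
  have tu: "0 \<le> t" "0 \<le> u" using T by (auto simp: t_def u_def)
  have IH: "log_walk A r (grid_increment \<gamma> T n) k = L t"
    using Suc by (simp add: t_def)
  have "norm (L u - L t) < pi" using osc[of k] Suc.prems by (simp add: dist_norm t_def u_def)
  hence Im: "\<bar>Im (L u - L t)\<bar> < pi" using abs_Im_le_cmod[of "L u - L t"] by linarith
  have "1 + grid_increment \<gamma> T n k / exp (L t) = exp (L u - L t)"
    using tu by (simp add: grid_increment_def t_def[symmetric] u_def[symmetric] exp_diff
        diff_divide_distrib L(2)[symmetric] del: of_nat_Suc)
  hence "Ln (1 + grid_increment \<gamma> T n k / exp (L t)) = L u - L t"
    using Im by (simp add: Ln_exp)
  thus ?case using IH Suc.prems incr[of k] by (simp add: log_step_def t_def u_def)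
qed (simp add: L)

text \<open>
  For a closed set \<open>A\<close> the discrete exit cannot happen before the continuous exit \<open>s\<close>, because the walk
  agrees with \<open>L\<close> on a fine grid until it stops. It cannot happen much later either: shortly after \<open>s\<close> the path is in
  the open complement of \<open>A\<close> during a whole time interval, which contains grid points.
\<close>

lemma (in log_walk_domain) log_walk_tendsto:
  assumes "closed A" and cont: "continuous_on {0..} L"
    and L: "L 0 = 0" "\<And>t. 0 \<le> t \<Longrightarrow> exp (L t) = \<gamma> t" and T: "0 < T"
  shows "(\<lambda>n. log_walk A r (grid_increment \<gamma> T n) n) \<longlonglongrightarrow> L (exit_before A L T)"
proof (rule tendstoI)
  fix e :: real assume e: "0 < e"
  define s where "s = exit_before A L T"
  have s: "0 \<le> s" "s \<le> T" using exit_before_bounds[of T A L] T by (auto simp: s_def)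
  obtain d where d: "d > 0" "\<And>t. 0 \<le> t \<Longrightarrow> dist t s < d \<Longrightarrow> dist (L t) (L s) < e"
    using cont s(1) e unfolding continuous_on_iff by (metis atLeast_iff)
  have cont\<gamma>: "continuous_on {0..} \<gamma>"
    using continuous_on_exp[OF cont] L(2) by (rule continuous_on_eq) auto
  have reach: "\<forall>\<^sub>F n in sequentially. \<exists>k\<le>n. (k = n \<or> L (real k * T / real n) \<notin> A) \<and> real k * T / real n < s + d"
  proof -
    have "exit_before A L T < s + d" using d by (simp add: s_def)
    then obtain t where t: "t < s + d" "t = T \<or> t \<in> {0..T} \<and> L t \<notin> A" by (rule exit_before_less)
    show ?thesis
    proof (cases "t = T")
      case True
      show ?thesis using eventually_gt_at_top[of 0]
        by eventually_elim (use True t in auto)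
    next
      case False
      hence t': "0 \<le> t" "t \<le> T" "L t \<in> -A" using t by auto
      have "open (- A)" using assms(1) by auto
      then obtain \<eta> where \<eta>: "\<eta> > 0" "ball (L t) \<eta> \<subseteq> - A"
        using t'(3) by (metis openE)
      obtain \<delta> where \<delta>: "\<delta> > 0" "\<And>u. 0 \<le> u \<Longrightarrow> dist u t < \<delta> \<Longrightarrow> dist (L u) (L t) < \<eta>"
        using cont t'(1) \<eta>(1) unfolding continuous_on_iff by (metis atLeast_iff)
      show ?thesis using eventually_grid_point_below[OF t'(1,2) T \<delta>(1)]
      proof eventually_elim
        case (elim n)
        then obtain k where k: "k \<le> n" "real k * T / real n \<in> {t - \<delta><..t}" by blast
        hence "dist (L (real k * T / real n)) (L t) < \<eta>"
          using T by (intro \<delta>(2)) (auto simp: dist_real_def)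
        hence "L (real k * T / real n) \<notin> A" using \<eta>(2) by (subst (asm) dist_commute) auto
        thus ?case using k t by (intro exI[of _ k]) auto
      qed
    qed
  qed
  show "\<forall>\<^sub>F n in sequentially. dist (log_walk A r (grid_increment \<gamma> T n) n) (L (exit_before A L T)) < e"
    using reach eventually_grid_oscillation[OF cont T pi_gt_zero]
      eventually_grid_oscillation[OF cont\<gamma> T r_pos] eventually_gt_at_top[of 0]
  proof eventually_elim
    case (elim n)
    define P where "P k \<longleftrightarrow> k \<le> n \<and> (k = n \<or> L (real k * T / real n) \<notin> A)" for k
    \<comment> \<open>the grid index at which the walk comes to rest\<close>
    define \<kappa> where "\<kappa> = (LEAST k. P k)"
    have "P n" by (simp add: P_def)
    hence P\<kappa>: "P \<kappa>" unfolding \<kappa>_def by (rule LeastI)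
    have before: "L (real j * T / real n) \<in> A" if "j < \<kappa>" for j
      using not_less_Least[of j P] that P\<kappa> unfolding \<kappa>_def[symmetric] by (auto simp: P_def)
    have walk: "log_walk A r (grid_increment \<gamma> T n) \<kappa> = L (real \<kappa> * T / real n)"
      using elim before P\<kappa>
      by (intro log_walk_eq_log_path L T) (auto simp: grid_increment_def dist_norm P_def)
    have "log_walk A r (grid_increment \<gamma> T n) n = L (real \<kappa> * T / real n)"
      using log_walk_stopped[of A r "grid_increment \<gamma> T n" \<kappa> n] walk P\<kappa> by (auto simp: P_def)
    moreover have "s \<le> real \<kappa> * T / real n"
    proof (cases "\<kappa> = n")
      case False
      have "real \<kappa> * T \<le> real n * T" using P\<kappa> T by (intro mult_right_mono) (auto simp: P_def)
      thus ?thesis using False P\<kappa> T elim unfolding s_def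
        by (intro exit_before_le) (auto simp: P_def field_simps)
    qed (use s elim in auto)
    moreover have "real \<kappa> * T / real n < s + d"
    proof -
      obtain k where k: "P k" "real k * T / real n < s + d" using elim(1) by (auto simp: P_def)
      have "real \<kappa> * T / real n \<le> real k * T / real n"
        using Least_le[of P k] k T by (intro divide_right_mono mult_right_mono) (auto simp: \<kappa>_def)
      thus ?thesis using k by simp
    qed
    ultimately show ?case using s d(2)[of "real \<kappa> * T / real n"]
      by (auto simp: dist_real_def s_def)
  qed
qed

text \<open>
  Before the path is known to avoid \<open>0\<close> it has no continuous logarithm to compare with. Here it is enough that
  the exponential of the walk follows the path up to the first grid time outside the annulus.
\<close>

lemma (in log_walk_domain) log_walk_near_zero_path:
  assumes A: "A = {Y. Re Y \<in> {a..b}}"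
    and cont: "continuous_on {0..} \<gamma>" and \<gamma>: "\<gamma> 0 = 1" and T: "0 < T"
    and bound: "\<And>t. t \<in> {0..T} \<Longrightarrow> norm (\<gamma> t) < exp b" and t: "t \<in> {0..T}" "\<gamma> t = 0"
  shows "\<forall>\<^sub>F n in sequentially. Re (log_walk A r (grid_increment \<gamma> T n) n) < a"
proof -
  have "exp a > 0" by simp
  then obtain d where d: "d > 0" "\<And>u. 0 \<le> u \<Longrightarrow> dist u t < d \<Longrightarrow> dist (\<gamma> u) (\<gamma> t) < exp a"
    using cont t(1) unfolding continuous_on_iff by (metis atLeast_iff atLeastAtMost_iff)
  have "0 \<le> t" "t \<le> T" using t by auto
  from eventually_grid_point_below[OF this T d(1)] eventually_grid_oscillation[OF cont T r_pos]
  show ?thesis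
  proof eventually_elim
    case (elim n)
    define W where "W = log_walk A r (grid_increment \<gamma> T n)"
    obtain k where k: "k \<le> n" "real k * T / real n \<in> {t - d<..t}" using elim(1) by blast
    have expW: "exp (W j) = \<gamma> (real j * T / real n)" if "j \<le> n" "\<And>i. i < j \<Longrightarrow> W i \<in> A" for j
      using elim(2) that unfolding W_def
      by (intro exp_log_walk \<gamma>) (auto simp: grid_increment_def dist_norm)
    have "\<exists>j\<le>k. W j \<notin> A"
    proof (rule ccontr)
      assume *: "\<not> ?thesis"
      have "dist (\<gamma> (real k * T / real n)) (\<gamma> t) < exp a"
        using k T by (intro d(2)) (auto simp: dist_real_def)
      hence "norm (exp (W k)) < exp a"
        using expW[of k] * k(1) t(2) by auto
      thus False using * A by auto
    qed
    then obtain j0 where j0: "j0 \<le> k" "W j0 \<notin> A" by blast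
    define j where "j = (LEAST j. W j \<notin> A)"
    have j: "W j \<notin> A" "j \<le> k" "\<And>i. i < j \<Longrightarrow> W i \<in> A"
      unfolding j_def
      using LeastI[of "\<lambda>j. W j \<notin> A", OF j0(2)] order_trans[OF Least_le[of "\<lambda>j. W j \<notin> A", OF j0(2)] j0(1)]
        not_less_Least[of _ "\<lambda>j. W j \<notin> A"] by blast+
    have "real j * T \<le> real n * T" using j k T by (intro mult_right_mono) auto
    hence "real j * T / real n \<in> {0..T}" using T by (auto simp: divide_le_eq)
    hence "norm (exp (W j)) < exp b"
      using expW[of j] j k(1) bound by auto
    hence "Re (W j) < a" using j(1) A by auto
    moreover have "W n = W j" unfolding W_def
      using j k(1) by (intro log_walk_stopped) (auto simp: W_def)
    ultimately show ?case by (simp add: W_def)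
  qed
qed

section \<open>Planar Brownian motion never hits the origin\<close>

text \<open>
  Used to exclude a set of paths whose measurability is not known: it suffices that every path in it
  belongs, for each \<open>K\<close>, to \<open>E K n\<close> for all large \<open>n\<close>.
\<close>

lemma (in prob_space) AE_not_eventually_unlikely:
  fixes E :: "nat \<Rightarrow> nat \<Rightarrow> 'a set"
  assumes E[measurable]: "\<And>K n. E K n \<in> events"
    and small: "\<And>K n. 0 < K \<Longrightarrow> 0 < n \<Longrightarrow> prob (E K n) \<le> c / real K"
  shows "AE \<omega> in M. \<exists>K>0. \<not> (\<forall>\<^sub>F n in sequentially. \<omega> \<in> E K n)"
proof -
  define F where "F K n = (\<Inter>m\<in>{n..}. E K (Suc m))" for K n
  have F[measurable]: "F K n \<in> events" for K n unfolding F_def by measurable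
  have FK: "prob (\<Union>n. F K n) \<le> c / real K" if "0 < K" for K
  proof (rule LIMSEQ_le_const2)
    show "(\<lambda>n. prob (F K n)) \<longlonglongrightarrow> prob (\<Union>n. F K n)"
      by (rule finite_Lim_measure_incseq) (auto simp: incseq_def F_def)
    have "prob (F K n) \<le> c / real K" for n
      using finite_measure_mono[of "F K n" "E K (Suc n)"] small[of K "Suc n"] that
      by (force simp: F_def)
    thus "\<exists>N. \<forall>n\<ge>N. prob (F K n) \<le> c / real K" by blast
  qed
  define N where "N = (\<Inter>K. \<Union>n. F (Suc K) n)"
  have N[measurable]: "N \<in> events" unfolding N_def by measurable
  have "prob N \<le> 0"
  proof (rule LIMSEQ_le_const)
    show "(\<lambda>K. c / real (Suc K)) \<longlonglongrightarrow> 0" by real_asymp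
    have "prob N \<le> c / real (Suc K)" for K
      using FK[of "Suc K"] finite_measure_mono[of N "\<Union>n. F (Suc K) n"] by (force simp: N_def)
    thus "\<exists>k. \<forall>K\<ge>k. prob N \<le> c / real (Suc K)" by blast
  qed
  hence "AE \<omega> in M. \<omega> \<notin> N"
    using measure_nonneg[of M N] by (subst AE_iff_measurable[OF N]) (auto simp: emeasure_eq_measure sets.sets_into_space[THEN subsetD, OF N])
  thus ?thesis
  proof eventually_elim
    case (elim \<omega>)
    then obtain K where K: "\<And>n. \<omega> \<notin> F (Suc K) n" by (auto simp: N_def)
    have "\<not> (\<forall>\<^sub>F n in sequentially. \<omega> \<in> E (Suc K) n)"
    proof
      assume "\<forall>\<^sub>F n in sequentially. \<omega> \<in> E (Suc K) n"
      then obtain n where "\<And>m. m \<ge> n \<Longrightarrow> \<omega> \<in> E (Suc K) m" by (auto simp: eventually_sequentially)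
      hence "\<omega> \<in> F (Suc K) n" by (auto simp: F_def)
      thus False using K by blast
    qed
    thus ?case by blast
  qed
qed

lemma norm_Ln_quotient_le:
  assumes "norm y < r" "r * exp (- Re Y) \<le> q" "q \<le> 1 / 2"
  shows "norm (Ln (1 + y / exp Y)) \<le> 2 * q" "norm y < norm (exp Y)"
proof -
  have n: "norm (y / exp Y) = norm y * exp (- Re Y)" by (simp add: norm_divide exp_minus field_simps)
  also have "\<dots> < r * exp (- Re Y)" using assms by (intro mult_strict_right_mono) auto
  finally have *: "norm (y / exp Y) < q" using assms by simp
  have "norm (Ln (1 + y / exp Y)) \<le> 2 * norm (y / exp Y)" by (rule norm_Ln_le) (use * assms in simp)
  thus "norm (Ln (1 + y / exp Y)) \<le> 2 * q" using * by simp
  have "norm (y / exp Y) < 1" using * assms by simp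
  thus "norm y < norm (exp Y)" by (simp add: norm_divide)
qed

lemma log_walk_domain_annulus:
  assumes "a < 0" "0 < b"
  shows "log_walk_domain {Y. Re Y \<in> {a..b}} (exp a / 4) {Y. Re Y \<in> {a - 1<..<b + 1}}"
proof
  have "closed ({Y. a \<le> Re Y} \<inter> {Y. Re Y \<le> b})"
    by (intro closed_Int closed_halfspace_Re_ge closed_halfspace_Re_le)
  also have "{Y. a \<le> Re Y} \<inter> {Y. Re Y \<le> b} = {Y. Re Y \<in> {a..b}}" by auto
  finally show "{Y. Re Y \<in> {a..b}} \<in> sets borel" by (rule borel_closed)
  fix Y y :: complex
  assume Y: "Y \<in> {Y. Re Y \<in> {a..b}}" and y: "norm y < exp a / 4"
  have q: "exp a / 4 * exp (- Re Y) \<le> 1 / 4" using Y by (simp add: exp_minus field_simps)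
  show "norm y < norm (exp Y)" using norm_Ln_quotient_le(2)[OF y q] by simp
  have "\<bar>Re (Ln (1 + y / exp Y))\<bar> \<le> 1 / 2"
    using norm_Ln_quotient_le(1)[OF y q] abs_Re_le_cmod[of "Ln (1 + y / exp Y)"] by linarith
  thus "Y + Ln (1 + y / exp Y) \<in> {Y. Re Y \<in> {a - 1<..<b + 1}}" using Y by auto
qed (use assms in auto)

text \<open>
  For a start on the unit circle and the annulus between the radii \<open>exp (- K)\<close> and \<open>exp R\<close>, the function
  \<open>Re Y = ln \<bar>z\<bar>\<close> has mean \<open>0\<close> along the walk, is at most \<open>R + 1\<close>, and is below \<open>- K\<close> when the walk ends inside
  the inner circle. So the latter has probability at most \<open>(R + 1) / K\<close>, uniformly in the grid, and a path
  that hits \<open>0\<close> inside the outer circle makes it happen for every \<open>K\<close> once the grid is fine.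
\<close>

lemma (in planar_brownian_motion) AE_never_zero:
  assumes z: "z = 1"
  shows "AE \<omega> in M. \<forall>t\<ge>0. B t \<omega> \<noteq> 0"
proof -
  define A where "A R K = {Y. Re Y \<in> {- real K..real R}}" for R K :: nat
  define D where "D R K = {Y. Re Y \<in> {- real K - 1<..<real R + 1}}" for R K :: nat
  define W where "W R T K n \<omega> = log_walk (A R K) (exp (- real K) / 4) (grid_increment (\<lambda>t. B t \<omega>) (real T) n) n"
    for R T K n \<omega>
  have dom: "log_walk_domain (A R K) (exp (- real K) / 4) (D R K)" if "0 < R" "0 < K" for R K
    using log_walk_domain_annulus[of "- real K" "real R"] that by (simp add: A_def D_def)
  have Wm[measurable]: "W R T K n \<in> borel_measurable M" if "0 < R" "0 < T" "0 < K" for R T K n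
    unfolding W_def using that log_walk_domain.A_borel[OF dom] by (intro measurable_log_walk_grid) auto
  define E where "E R T K n = {\<omega> \<in> space M. 0 < K \<and> Re (W R T K n \<omega>) < - real K}" for R T K n
  have Em[measurable]: "E R T K n \<in> events" if "0 < R" "0 < T" for R T K n
    using that by (cases "K = 0") (auto simp: E_def)
  have small: "prob (E R T K n) \<le> (real R + 1) / real K" if pos: "0 < R" "0 < T" "0 < K" "0 < n" for R T K n
  proof -
    interpret log_walk_domain "A R K" "exp (- real K) / 4" "D R K" by (rule dom) fact+
    have D: "W R T K n \<omega> \<in> D R K" for \<omega> unfolding W_def by (rule log_walk_in_D)
    have "\<bar>Re (W R T K n \<omega>)\<bar> \<le> real R + real K + 1" for \<omega>
      using D[of \<omega>] by (auto simp: D_def)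
    hence int: "integrable M (\<lambda>\<omega>. Re (W R T K n \<omega>))"
      using Wm[of R T K n] pos by (intro integrable_const_bound[of _ "real R + real K + 1"]) auto
    have intE: "integrable M (indicat_real (E R T K n))"
      using Em[OF pos(1,2)] by (simp add: less_top[symmetric])
    have "0 = expectation (\<lambda>\<omega>. Re (W R T K n \<omega>))"
      unfolding W_def
      by (subst expectation_log_walk[OF dom, of R K "real T" n "\<lambda>Y. Y" Re "real R + real K + 1"])
         (use pos in \<open>auto simp: D_def\<close>)
    also have "\<dots> \<le> expectation (\<lambda>\<omega>. real R + 1 - real K * indicator (E R T K n) \<omega>)"
    proof (rule integral_mono[OF int])
      fix \<omega> assume "\<omega> \<in> space M"
      thus "Re (W R T K n \<omega>) \<le> real R + 1 - real K * indicator (E R T K n) \<omega>"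
        using D[of \<omega>] by (auto simp: D_def E_def indicator_def)
    qed (use intE in simp)
    also have "\<dots> = real R + 1 - real K * prob (E R T K n)"
      using intE Em[OF pos(1,2)] by (simp add: prob_space)
    finally show ?thesis using pos by (simp add: field_simps)
  qed
  have "AE \<omega> in M. \<exists>K>0. \<not> (\<forall>\<^sub>F n in sequentially. \<omega> \<in> E (Suc R) (Suc T) K n)" for R T
    by (rule AE_not_eventually_unlikely[of _ "real (Suc R) + 1", OF Em small]) auto
  hence "AE \<omega> in M. \<forall>R T. \<exists>K>0. \<not> (\<forall>\<^sub>F n in sequentially. \<omega> \<in> E (Suc R) (Suc T) K n)"
    unfolding AE_all_countable by blast
  with start continuous_paths AE_space show ?thesis
  proof eventually_elim
    case (elim \<omega>)
    show ?case
    proof (intro allI impI notI)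
      fix t :: real assume t: "0 \<le> t" "B t \<omega> = 0"
      obtain T where T: "t \<le> real (Suc T)"
        using real_arch_simple[of t] by (metis less_imp_le less_Suc_eq_le of_nat_le_iff order_trans lessI)
      have "bounded ((\<lambda>t. B t \<omega>) ` {0..real (Suc T)})"
        using elim by (intro compact_imp_bounded compact_continuous_image continuous_on_subset[OF elim(2)]) auto
      then obtain c where c: "\<And>t. t \<in> {0..real (Suc T)} \<Longrightarrow> norm (B t \<omega>) \<le> c"
        unfolding bounded_iff by blast
      obtain R :: nat where R: "c < real R" using reals_Archimedean2 by blast
      have cR: "norm (B t \<omega>) < exp (real (Suc R))" if "t \<in> {0..real (Suc T)}" for t
        using c[OF that] R exp_ge_add_one_self[of "real (Suc R)"] by simp
      obtain K where K: "K > 0" "\<not> (\<forall>\<^sub>F n in sequentially. \<omega> \<in> E (Suc R) (Suc T) K n)"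
        using elim(4) by blast
      interpret log_walk_domain "A (Suc R) K" "exp (- real K) / 4" "D (Suc R) K"
        using K by (intro dom) auto
      have "\<forall>\<^sub>F n in sequentially. Re (W (Suc R) (Suc T) K n \<omega>) < - real K"
        unfolding W_def using elim cR t T z
        by (intro log_walk_near_zero_path[of "- real K" "real (Suc R)"]) (auto simp: A_def)
      hence "\<forall>\<^sub>F n in sequentially. \<omega> \<in> E (Suc R) (Suc T) K n"
        by eventually_elim (use K elim(3) in \<open>auto simp: E_def\<close>)
      thus False using K by blast
    qed
  qed
qed

section \<open>Optional stopping in a strip\<close>

definition log_strip :: "real \<Rightarrow> real \<Rightarrow> complex set" where
  "log_strip \<alpha> \<beta> = {Y. Im Y \<in> {\<alpha><..<\<beta>}}"

definition log_box :: "real \<Rightarrow> real \<Rightarrow> nat \<Rightarrow> complex set" where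
  "log_box \<alpha> \<beta> m = {Y. \<bar>Re Y\<bar> \<le> real m \<and> Im Y \<in> {\<alpha> + 1 / (real m + 1)..\<beta> - 1 / (real m + 1)}}"

lemma closed_log_box: "closed (log_box \<alpha> \<beta> m)"
proof -
  have "log_box \<alpha> \<beta> m = cbox (Complex (- real m) (\<alpha> + 1 / (real m + 1))) (Complex (real m) (\<beta> - 1 / (real m + 1)))"
    by (auto simp: log_box_def in_cbox_complex_iff)
  thus ?thesis by (simp add: closed_cbox)
qed

lemma log_box_subset_strip: "log_box \<alpha> \<beta> m \<subseteq> log_strip \<alpha> \<beta>"
proof
  fix Y assume "Y \<in> log_box \<alpha> \<beta> m"
  moreover have "1 / (real m + 1) > 0" by simp
  ultimately have "\<alpha> < Im Y" "Im Y < \<beta>"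
    unfolding log_box_def mem_Collect_eq atLeastAtMost_iff by linarith+
  thus "Y \<in> log_strip \<alpha> \<beta>" by (simp add: log_strip_def)
qed

text \<open>
  The box is at distance \<open>1 / (m + 1)\<close> from the boundary of the strip. On it \<open>norm (exp Y) \<ge> exp (- m)\<close>, so the
  bound on the increment makes a step move \<open>Y\<close> by at most half of that distance.
\<close>

lemma log_walk_domain_box:
  assumes "\<alpha> < 0" "0 < \<beta>"
  shows "log_walk_domain (log_box \<alpha> \<beta> m) (exp (- real m) / (4 * (real m + 1))) (log_strip \<alpha> \<beta>)"
proof
  show "log_box \<alpha> \<beta> m \<in> sets borel" by (intro borel_closed closed_log_box)
  fix Y y :: complex
  assume Y: "Y \<in> log_box \<alpha> \<beta> m" and y: "norm y < exp (- real m) / (4 * (real m + 1))"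
  let ?q = "1 / (4 * (real m + 1))"
  have "exp (- real m) * exp (- Re Y) \<le> exp (- real m) * exp (real m)"
    using Y by (intro mult_left_mono) (auto simp: log_box_def)
  hence "exp (- real m) * exp (- Re Y) \<le> 1" by (simp add: exp_minus)
  hence q: "exp (- real m) / (4 * (real m + 1)) * exp (- Re Y) \<le> ?q"
    by (simp add: divide_right_mono)
  have q2: "?q \<le> 1 / 2" by (simp add: field_simps)
  show "norm y < norm (exp Y)" by (rule norm_Ln_quotient_le(2)[OF y q q2])
  have "\<bar>Im (Ln (1 + y / exp Y))\<bar> \<le> 2 * ?q"
    using norm_Ln_quotient_le(1)[OF y q q2] abs_Im_le_cmod[of "Ln (1 + y / exp Y)"] by linarith
  also have "\<dots> < 1 / (real m + 1)" by (simp add: field_simps)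
  finally show "Y + Ln (1 + y / exp Y) \<in> log_strip \<alpha> \<beta>"
    using Y unfolding log_strip_def log_box_def by (auto simp: abs_less_iff)
qed (use assms in \<open>auto simp: log_strip_def\<close>)

lemma log_box_absorbs:
  assumes "compact I" "continuous_on I L" "L ` I \<subseteq> log_strip \<alpha> \<beta>"
  shows "\<forall>\<^sub>F m in sequentially. L ` I \<subseteq> log_box \<alpha> \<beta> m"
proof (cases "I = {}")
  case False
  have cIm: "continuous_on I (\<lambda>t. Im (L t))" by (intro continuous_intros assms)
  obtain t1 where t1: "t1 \<in> I" "\<And>t. t \<in> I \<Longrightarrow> Im (L t1) \<le> Im (L t)"
    using continuous_attains_inf[OF assms(1) False cIm] by blast
  obtain t2 where t2: "t2 \<in> I" "\<And>t. t \<in> I \<Longrightarrow> Im (L t) \<le> Im (L t2)"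
    using continuous_attains_sup[OF assms(1) False cIm] by blast
  have "bounded (L ` I)" by (intro compact_imp_bounded compact_continuous_image assms)
  then obtain c where c: "\<And>t. t \<in> I \<Longrightarrow> norm (L t) \<le> c" unfolding bounded_iff by blast
  have lim: "((\<lambda>m. 1 / (real m + 1)) \<longlongrightarrow> 0) sequentially" by real_asymp
  have "\<forall>\<^sub>F m in sequentially. 1 / (real m + 1) < Im (L t1) - \<alpha>"
    using t1(1) assms(3) by (intro order_tendstoD[OF lim]) (auto simp: log_strip_def)
  moreover have "\<forall>\<^sub>F m in sequentially. 1 / (real m + 1) < \<beta> - Im (L t2)"
    using t2(1) assms(3) by (intro order_tendstoD[OF lim]) (auto simp: log_strip_def)
  moreover have "\<forall>\<^sub>F m in sequentially. c \<le> real m"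
    using filterlim_real_sequentially by (simp add: filterlim_at_top)
  ultimately show ?thesis
  proof eventually_elim
    case (elim m)
    show ?case
    proof (rule image_subsetI)
      fix t assume t: "t \<in> I"
      have "\<bar>Re (L t)\<bar> \<le> real m" using abs_Re_le_cmod[of "L t"] c[OF t] elim by linarith
      thus "L t \<in> log_box \<alpha> \<beta> m" using t1(2)[OF t] t2(2)[OF t] elim by (auto simp: log_box_def)
    qed
  qed
qed auto

text \<open>
  Up to any time before the exit from the open strip the path is compact in the strip, hence in a box.
\<close>

lemma exit_before_box_tendsto:
  assumes cont: "continuous_on {0..} L" and T: "0 \<le> T"
  shows "(\<lambda>m. L (exit_before (log_box \<alpha> \<beta> m) L T)) \<longlonglongrightarrow> L (exit_before (log_strip \<alpha> \<beta>) L T)"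
proof -
  define s where "s = exit_before (log_strip \<alpha> \<beta>) L T"
  define sm where "sm m = exit_before (log_box \<alpha> \<beta> m) L T" for m
  have s: "0 \<le> s" "s \<le> T" and sm0: "0 \<le> sm m" for m
    using exit_before_bounds[OF T] by (auto simp: s_def sm_def)
  have sm: "sm m \<le> s" for m
    unfolding s_def sm_def by (rule exit_before_mono[OF log_box_subset_strip T])
  have "sm \<longlonglongrightarrow> s"
  proof (rule tendstoI)
    fix e :: real assume e: "0 < e"
    define u where "u = s - e / 2"
    have "\<forall>\<^sub>F m in sequentially. L ` {0..u} \<subseteq> log_box \<alpha> \<beta> m"
    proof (rule log_box_absorbs)
      show "continuous_on {0..u} L" by (rule continuous_on_subset[OF cont]) auto
      show "L ` {0..u} \<subseteq> log_strip \<alpha> \<beta>"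
        using e in_before_exit_before[OF T, of _ "log_strip \<alpha> \<beta>" L] by (auto simp: u_def s_def)
    qed auto
    thus "\<forall>\<^sub>F m in sequentially. dist (sm m) s < e"
    proof eventually_elim
      case (elim m)
      have "u \<le> sm m"
      proof (rule ccontr)
        assume "\<not> u \<le> sm m"
        hence "exit_before (log_box \<alpha> \<beta> m) L T < u" by (simp add: sm_def)
        then obtain t where "t < u" "t = T \<or> t \<in> {0..T} \<and> L t \<notin> log_box \<alpha> \<beta> m"
          by (rule exit_before_less)
        thus False using elim s e by (auto simp: u_def image_subset_iff)
      qed
      thus ?case using sm[of m] e by (auto simp: u_def dist_real_def)
    qed
  qed
  hence "(\<lambda>m. L (sm m)) \<longlonglongrightarrow> L s"
    using s sm0 by (intro continuous_on_tendsto_compose[OF cont]) auto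
  thus ?thesis by (simp add: s_def sm_def)
qed

text \<open>
  In the simply connected strip, harmonic functions are the real parts of holomorphic ones.
\<close>

definition bounded_strip_harmonic :: "real \<Rightarrow> real \<Rightarrow> (complex \<Rightarrow> real) \<Rightarrow> bool" where
  "bounded_strip_harmonic \<alpha> \<beta> h \<longleftrightarrow>
     h \<in> borel_measurable borel \<and> continuous_on {Y. Im Y \<in> {\<alpha>..\<beta>}} h \<and>
     (\<exists>C. \<forall>Y. Im Y \<in> {\<alpha>..\<beta>} \<longrightarrow> \<bar>h Y\<bar> \<le> C) \<and>
     (\<exists>G. G holomorphic_on log_strip \<alpha> \<beta> \<and> (\<forall>Y\<in>log_strip \<alpha> \<beta>. h Y = Re (G Y)))"

lemma bounded_strip_harmonicI:
  assumes "h \<in> borel_measurable borel" "G holomorphic_on log_strip \<alpha> \<beta>"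
    and "\<And>Y. Y \<in> log_strip \<alpha> \<beta> \<Longrightarrow> h Y = Re (G Y)"
    and "continuous_on {Y. Im Y \<in> {\<alpha>..\<beta>}} h" "\<And>Y. Im Y \<in> {\<alpha>..\<beta>} \<Longrightarrow> \<bar>h Y\<bar> \<le> C"
  shows "bounded_strip_harmonic \<alpha> \<beta> h"
  using assms unfolding bounded_strip_harmonic_def by blast

definition is_log_path :: "(real \<Rightarrow> complex) \<Rightarrow> (real \<Rightarrow> complex) \<Rightarrow> bool" where
  "is_log_path \<gamma> L \<longleftrightarrow> continuous_on {0..} L \<and> L 0 = 0 \<and> (\<forall>t\<ge>0. exp (L t) = \<gamma> t)"

definition log_path :: "(real \<Rightarrow> complex) \<Rightarrow> real \<Rightarrow> complex" where
  "log_path \<gamma> = (SOME L. is_log_path \<gamma> L)"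

lemma is_log_path_log_path:
  assumes "continuous_on {0..} \<gamma>" "\<gamma> 0 = 1" "\<And>t. 0 \<le> t \<Longrightarrow> \<gamma> t \<noteq> 0"
  shows "is_log_path \<gamma> (log_path \<gamma>)"
proof -
  obtain g where g: "continuous_on {0..} g" "\<And>t. t \<in> {0..} \<Longrightarrow> \<gamma> t = exp (g t)"
    using continuous_logarithm_on_contractible[OF assms(1) convex_imp_contractible] assms(3)
    by (metis atLeast_iff convex_real_interval(1))
  have "is_log_path \<gamma> (\<lambda>t. g t - g 0)"
    unfolding is_log_path_def using g assms(2) by (auto intro!: continuous_intros simp: exp_diff)
  thus ?thesis unfolding log_path_def by (rule someI[of "is_log_path \<gamma>"])
qed

lemma exit_before_strip_closure:
  assumes cont: "continuous_on {0..} L" and T: "0 \<le> T" and L0: "L 0 = 0" and ab: "\<alpha> < 0" "0 < \<beta>"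
  shows "Im (L (exit_before (log_strip \<alpha> \<beta>) L T)) \<in> {\<alpha>..\<beta>}"
proof -
  define s where "s = exit_before (log_strip \<alpha> \<beta>) L T"
  have s: "0 \<le> s" using exit_before_bounds[OF T] by (auto simp: s_def)
  show ?thesis
  proof (cases "s = 0")
    case True
    thus ?thesis using L0 ab by (simp add: s_def[symmetric])
  next
    case False
    have "(\<lambda>n. s - s / real (Suc n)) \<longlonglongrightarrow> s" by real_asymp
    hence "(\<lambda>n. L (s - s / real (Suc n))) \<longlonglongrightarrow> L s"
      using s by (intro continuous_on_tendsto_compose[OF cont]) (auto simp: field_simps)
    hence lim: "(\<lambda>n. Im (L (s - s / real (Suc n)))) \<longlonglongrightarrow> Im (L s)" by (rule tendsto_Im)
    have "L (s - s / real (Suc n)) \<in> log_strip \<alpha> \<beta>" for n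
      using s False by (intro in_before_exit_before[OF T]) (auto simp: s_def[symmetric] field_simps)
    hence "Im (L (s - s / real (Suc n))) \<in> {\<alpha>..\<beta>}" for n by (auto simp: log_strip_def less_imp_le)
    thus ?thesis unfolding s_def[symmetric]
      by (intro closed_sequentially[OF _ _ lim]) auto
  qed
qed

context planar_brownian_motion
begin

definition bm_log :: "'w \<Rightarrow> real \<Rightarrow> complex" where "bm_log \<omega> = log_path (\<lambda>t. B t \<omega>)"

lemma AE_is_log_path:
  assumes "z = 1"
  shows "AE \<omega> in M. is_log_path (\<lambda>t. B t \<omega>) (bm_log \<omega>)"
  using start continuous_paths AE_never_zero[OF assms]
  by eventually_elim (auto simp: bm_log_def assms intro!: is_log_path_log_path)

text \<open>
  Two limits under bounded convergence: the grid gets finer for a fixed box, then the boxes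
  exhaust the strip. The variables \<open>W T\<close> are defined as limits of walks, and not through the path,
  because \<open>bm_log\<close> need not be measurable.
\<close>

lemma stopped_log_harmonic:
  assumes z: "z = 1" and ab: "\<alpha> < 0" "0 < \<beta>"
  obtains W where
    "\<And>T. W T \<in> borel_measurable M"
    "AE \<omega> in M. \<forall>T. W T \<omega> = bm_log \<omega> (exit_before (log_strip \<alpha> \<beta>) (bm_log \<omega>) (real T))"
    "\<And>T h. 0 < T \<Longrightarrow> bounded_strip_harmonic \<alpha> \<beta> h \<Longrightarrow> expectation (\<lambda>\<omega>. h (W T \<omega>)) = h 0"
proof -
  define S where "S = log_strip \<alpha> \<beta>"
  define r where "r m = exp (- real m) / (4 * (real m + 1))" for m
  define V where "V T m n \<omega> = log_walk (log_box \<alpha> \<beta> m) (r m) (grid_increment (\<lambda>t. B t \<omega>) (real T) n) n" for T m n \<omega>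
  \<comment> \<open>for \<open>T = 0\<close> the grid increments are not covered by the convergence result\<close>
  define U where "U T m \<omega> = (if T = 0 then 0 else lim (\<lambda>n. V T m n \<omega>))" for T m \<omega>
  define W where "W T \<omega> = lim (\<lambda>m. U T m \<omega>)" for T \<omega>
  have dom: "log_walk_domain (log_box \<alpha> \<beta> m) (r m) S" for m
    unfolding r_def S_def by (rule log_walk_domain_box[OF ab])
  have VS: "V T m n \<omega> \<in> S" for T m n \<omega>
    unfolding V_def by (rule log_walk_domain.log_walk_in_D[OF dom])
  have [measurable]: "V T m n \<in> borel_measurable M" if "T \<noteq> 0" for T m n
    unfolding V_def using that log_walk_domain.A_borel[OF dom] by (intro measurable_log_walk_grid) auto
  have Um[measurable]: "U T m \<in> borel_measurable M" for T m
    by (cases "T = 0") (auto simp: U_def[abs_def])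
  have Wm: "W T \<in> borel_measurable M" for T unfolding W_def by measurable
  have V_lim: "AE \<omega> in M. \<forall>T m. 0 < T \<longrightarrow> (\<lambda>n. V T m n \<omega>) \<longlonglongrightarrow>
      bm_log \<omega> (exit_before (log_box \<alpha> \<beta> m) (bm_log \<omega>) (real T))"
    using AE_is_log_path[OF z]
    by eventually_elim (auto simp: V_def is_log_path_def intro!: log_walk_domain.log_walk_tendsto[OF dom] closed_log_box)
  hence U_eq: "AE \<omega> in M. \<forall>T m. U T m \<omega> = bm_log \<omega> (exit_before (log_box \<alpha> \<beta> m) (bm_log \<omega>) (real T))"
    using AE_is_log_path[OF z]
  proof eventually_elim
    case (elim \<omega>)
    show ?case
    proof (intro allI)
      fix T m
      show "U T m \<omega> = bm_log \<omega> (exit_before (log_box \<alpha> \<beta> m) (bm_log \<omega>) (real T))"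
      proof (cases "T = 0")
        case True
        hence "exit_before (log_box \<alpha> \<beta> m) (bm_log \<omega>) (real T) = 0"
          using exit_before_bounds[of "real T" "log_box \<alpha> \<beta> m" "bm_log \<omega>"] by simp
        thus ?thesis using True elim(2) by (simp add: U_def is_log_path_def)
      qed (use elim(1) in \<open>simp add: U_def limI\<close>)
    qed
  qed
  hence U_lim: "AE \<omega> in M. \<forall>T. (\<lambda>m. U T m \<omega>) \<longlonglongrightarrow> bm_log \<omega> (exit_before S (bm_log \<omega>) (real T))"
    using AE_is_log_path[OF z]
    by eventually_elim (auto simp: S_def is_log_path_def intro!: exit_before_box_tendsto)
  hence W_eq: "AE \<omega> in M. \<forall>T. W T \<omega> = bm_log \<omega> (exit_before S (bm_log \<omega>) (real T))"
    by eventually_elim (auto simp: W_def limI)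
  show thesis
  proof (rule that)
    show "W T \<in> borel_measurable M" for T by (rule Wm)
    show "AE \<omega> in M. \<forall>T. W T \<omega> = bm_log \<omega> (exit_before (log_strip \<alpha> \<beta>) (bm_log \<omega>) (real T))"
      using W_eq by (simp add: S_def)
    fix T :: nat and h
    assume T: "0 < T" and harm: "bounded_strip_harmonic \<alpha> \<beta> h"
    then obtain G C where h[measurable]: "h \<in> borel_measurable borel"
      and G: "G holomorphic_on log_strip \<alpha> \<beta>" and hG: "\<And>Y. Y \<in> log_strip \<alpha> \<beta> \<Longrightarrow> h Y = Re (G Y)"
      and hc: "continuous_on {Y. Im Y \<in> {\<alpha>..\<beta>}} h" and C: "\<And>Y. Im Y \<in> {\<alpha>..\<beta>} \<Longrightarrow> \<bar>h Y\<bar> \<le> C"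
      unfolding bounded_strip_harmonic_def by blast
    have C0: "\<bar>h Y\<bar> \<le> C" if "Y \<in> S" for Y using that C by (auto simp: S_def log_strip_def)
    have U_closed: "AE \<omega> in M. \<forall>m. Im (U T m \<omega>) \<in> {\<alpha>..\<beta>}"
    proof -
      have *: "Im (bm_log \<omega> (exit_before (log_box \<alpha> \<beta> m) (bm_log \<omega>) (real T))) \<in> {\<alpha>..\<beta>}"
        if "(\<lambda>n. V T m n \<omega>) \<longlonglongrightarrow> bm_log \<omega> (exit_before (log_box \<alpha> \<beta> m) (bm_log \<omega>) (real T))" for \<omega> m
        using VS[of T m _ \<omega>]
        by (intro closed_sequentially[OF _ _ tendsto_Im[OF that]]) (auto simp: S_def log_strip_def less_imp_le)
      from V_lim U_eq show ?thesis by eventually_elim (use T * in auto)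
    qed
    have EU: "expectation (\<lambda>\<omega>. h (U T m \<omega>)) = h 0" for m
    proof -
      have "(\<lambda>n. expectation (\<lambda>\<omega>. h (V T m (Suc n) \<omega>))) \<longlonglongrightarrow> expectation (\<lambda>\<omega>. h (U T m \<omega>))"
      proof (rule integral_dominated_convergence[where w = "\<lambda>_. C"])
        show "AE \<omega> in M. (\<lambda>n. h (V T m (Suc n) \<omega>)) \<longlonglongrightarrow> h (U T m \<omega>)"
          using V_lim U_eq U_closed
        proof eventually_elim
          case (elim \<omega>)
          have "(\<lambda>n. V T m n \<omega>) \<longlonglongrightarrow> U T m \<omega>" using elim T by auto
          hence "(\<lambda>n. V T m (Suc n) \<omega>) \<longlonglongrightarrow> U T m \<omega>" by (rule LIMSEQ_Suc)
          thus ?case using elim VS[of T m _ \<omega>]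
            by (intro continuous_on_tendsto_compose[OF hc]) (auto simp: S_def log_strip_def less_imp_le)
        qed
      qed (use T C0 VS in \<open>auto\<close>)
      moreover have "expectation (\<lambda>\<omega>. h (V T m (Suc n) \<omega>)) = h 0" for n
        unfolding V_def using T G hG C0
        by (intro expectation_log_walk[OF dom, where G = G and C = C]) (auto simp: S_def)
      ultimately show ?thesis by (simp add: LIMSEQ_const_iff)
    qed
    have W_closed: "AE \<omega> in M. Im (W T \<omega>) \<in> {\<alpha>..\<beta>}"
      using AE_is_log_path[OF z] W_eq
      by eventually_elim (use exit_before_strip_closure[OF _ _ _ ab] in \<open>auto simp: is_log_path_def S_def\<close>)
    have "(\<lambda>m. expectation (\<lambda>\<omega>. h (U T m \<omega>))) \<longlonglongrightarrow> expectation (\<lambda>\<omega>. h (W T \<omega>))"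
    proof (rule integral_dominated_convergence[where w = "\<lambda>_. C"])
      show "AE \<omega> in M. (\<lambda>m. h (U T m \<omega>)) \<longlonglongrightarrow> h (W T \<omega>)"
        using U_lim W_eq U_closed W_closed
        by eventually_elim (auto intro!: continuous_on_tendsto_compose[OF hc])
      show "AE \<omega> in M. norm (h (U T m \<omega>)) \<le> C" for m
        using U_closed by eventually_elim (use C in auto)
    qed (use Wm in auto)
    thus "expectation (\<lambda>\<omega>. h (W T \<omega>)) = h 0" by (simp add: EU LIMSEQ_const_iff)
  qed
qed

end

section \<open>The strip is left in finite time\<close>

text \<open>
  The complement of \<open>S\<close> is closed, so the infimum of the exit times is attained.
\<close>

lemma first_exit_exists:
  assumes cont: "continuous_on {0..} L" and S: "open S" and t: "0 \<le> t" "L t \<notin> S"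
  obtains \<tau> where "0 \<le> \<tau>" "L \<tau> \<notin> S" "\<And>u. 0 \<le> u \<Longrightarrow> u < \<tau> \<Longrightarrow> L u \<in> S"
    "\<And>T. \<tau> \<le> T \<Longrightarrow> exit_before S L T = \<tau>"
proof -
  define H where "H = {u \<in> {0..}. L u \<in> - S}"
  have "H = {0..} \<inter> L -` (- S)" by (auto simp: H_def)
  hence "closed H" using continuous_closed_preimage[OF cont closed_atLeast, of "- S"] S by (simp add: closed_Compl)
  moreover have "H \<noteq> {}" "bdd_below H" using t by (auto simp: H_def intro!: bdd_belowI[of _ 0])
  ultimately have H: "Inf H \<in> H" by (intro closed_contains_Inf)
  have before: "L u \<in> S" if "0 \<le> u" "u < Inf H" for u
    using cInf_lower[of u H] \<open>bdd_below H\<close> that by (force simp: H_def)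
  show thesis
  proof (rule that)
    show "0 \<le> Inf H" "L (Inf H) \<notin> S" using H by (auto simp: H_def)
    fix T assume T: "Inf H \<le> T"
    show "exit_before S L T = Inf H"
    proof (rule antisym)
      show "exit_before S L T \<le> Inf H"
        using H T by (intro exit_before_le) (auto simp: H_def)
      show "Inf H \<le> exit_before S L T"
      proof (rule ccontr)
        assume "\<not> Inf H \<le> exit_before S L T"
        hence "exit_before S L T < Inf H" by simp
        then obtain u where "u < Inf H" "u = T \<or> u \<in> {0..T} \<and> L u \<notin> S"
          by (rule exit_before_less)
        thus False using before T by auto
      qed
    qed
  qed (rule before)
qed

lemma exit_before_no_exit:
  assumes "0 \<le> T" "\<And>t. 0 \<le> t \<Longrightarrow> L t \<in> S"
  shows "exit_before S L T = T"
proof -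
  have "insert T {t \<in> {0..T}. L t \<notin> S} = {T}" using assms by auto
  thus ?thesis unfolding exit_before_def by (simp only: cInf_singleton)
qed

lemma open_log_strip: "open (log_strip \<alpha> \<beta>)"
proof -
  have "log_strip \<alpha> \<beta> = {Y. \<alpha> < Im Y} \<inter> {Y. Im Y < \<beta>}" by (auto simp: log_strip_def)
  thus ?thesis by (simp add: open_Int open_halfspace_Im_gt open_halfspace_Im_lt)
qed

definition is_first_exit_value :: "complex set \<Rightarrow> (real \<Rightarrow> complex) \<Rightarrow> complex \<Rightarrow> bool" where
  "is_first_exit_value S L Y \<longleftrightarrow>
     (\<exists>\<tau>\<ge>0. Y = L \<tau> \<and> Y \<notin> S \<and> (\<forall>t. 0 \<le> t \<longrightarrow> t < \<tau> \<longrightarrow> L t \<in> S))"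

context planar_brownian_motion
begin

text \<open>
  The density of \<open>B T - B 0\<close> is at most \<open>1 / T\<close>, and the event confines this difference to a square of side \<open>2 * (R + 1)\<close>.
\<close>

lemma prob_near_origin_le:
  assumes z: "z = 1" and T: "0 < T" and R: "0 \<le> R"
  shows "prob {\<omega> \<in> space M. norm (B T \<omega>) \<le> R} \<le> 4 * (R + 1)\<^sup>2 / T"
proof -
  let ?g = "\<lambda>w. normal_density 0 (sqrt (T - 0)) (Re w) * normal_density 0 (sqrt (T - 0)) (Im w)"
  have d: "distributed M lborel (\<lambda>\<omega>. B T \<omega> - B 0 \<omega>) (\<lambda>w. ennreal (?g w))"
    using T by (intro normal_increments) auto
  define Q where "Q = cbox (Complex (- (R + 1)) (- (R + 1))) (Complex (R + 1) (R + 1))"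
  have nd: "normal_density 0 (sqrt (T - 0)) x \<le> 1 / sqrt T" for x
  proof -
    have "normal_density 0 (sqrt (T - 0)) x \<le> 1 / sqrt (2 * pi * T) * 1"
      unfolding normal_density_def using T by (intro mult_mono) auto
    also have "\<dots> \<le> 1 / sqrt T"
      using T pi_gt3 by (auto intro!: divide_left_mono)
    finally show ?thesis .
  qed
  have g: "?g w \<le> 1 / T" for w
  proof -
    have "?g w \<le> (1 / sqrt T) * (1 / sqrt T)" using T by (intro mult_mono nd) auto
    thus ?thesis using T by simp
  qed
  have "emeasure M ((\<lambda>\<omega>. B T \<omega> - B 0 \<omega>) -` Q \<inter> space M) = (\<integral>\<^sup>+w. ennreal (?g w) * indicator Q w \<partial>lborel)"
    by (rule distributed_emeasure[OF d]) (simp add: Q_def)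
  also have "\<dots> \<le> (\<integral>\<^sup>+w. ennreal (1 / T) * indicator Q w \<partial>lborel)"
    by (intro nn_integral_mono mult_right_mono ennreal_leI g) auto
  also have "\<dots> = ennreal (1 / T) * emeasure lborel Q"
    by (simp add: nn_integral_cmult_indicator Q_def)
  also have "emeasure lborel Q = ennreal ((2 * (R + 1)) * (2 * (R + 1)))"
    unfolding Q_def using R by (subst emeasure_lborel_cbox) (auto simp: Basis_complex_def algebra_simps)
  also have "ennreal (1 / T) * \<dots> = ennreal (4 * (R + 1)\<^sup>2 / T)"
    using T R by (subst ennreal_mult[symmetric]) (auto simp: power2_eq_square field_simps)
  finally have le: "prob ((\<lambda>\<omega>. B T \<omega> - B 0 \<omega>) -` Q \<inter> space M) \<le> 4 * (R + 1)\<^sup>2 / T"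
    using T by (simp add: emeasure_eq_measure)
  have [measurable]: "B T \<in> borel_measurable M" "B 0 \<in> borel_measurable M"
    using T by (auto intro: measurable_B)
  have "prob {\<omega> \<in> space M. norm (B T \<omega>) \<le> R} \<le> prob ((\<lambda>\<omega>. B T \<omega> - B 0 \<omega>) -` Q \<inter> space M)"
  proof (rule finite_measure_mono_AE)
    show "AE \<omega> in M. \<omega> \<in> {\<omega> \<in> space M. norm (B T \<omega>) \<le> R} \<longrightarrow> \<omega> \<in> (\<lambda>\<omega>. B T \<omega> - B 0 \<omega>) -` Q \<inter> space M"
      using start
    proof eventually_elim
      case (elim \<omega>)
      have "\<bar>Re (B T \<omega>)\<bar> \<le> norm (B T \<omega>)" "\<bar>Im (B T \<omega>)\<bar> \<le> norm (B T \<omega>)"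
        by (rule abs_Re_le_cmod abs_Im_le_cmod)+
      thus ?case using elim z by (auto simp: Q_def in_cbox_complex_iff)
    qed
    show "(\<lambda>\<omega>. B T \<omega> - B 0 \<omega>) -` Q \<inter> space M \<in> events"
      by (rule measurable_sets[of _ M borel]) (auto simp: Q_def)
  qed
  thus ?thesis using le by simp
qed

text \<open>
  With \<open>\<phi>\<close> the middle of the strip and \<open>b = pi / (2 * (\<beta> - \<alpha>))\<close>, the function \<open>exp (b * (Y - \<i> * \<phi>))\<close> maps the strip into the
  sector \<open>\<bar>arg\<bar> \<le> pi / 4\<close>, so its real part is at least \<open>exp (b * Re Y) / 2\<close>. Hence
  \<open>G \<delta> Y = exp (- \<delta> * exp (b * (Y - \<i> * \<phi>)))\<close> is bounded by \<open>1\<close>, tends to \<open>1\<close> at the start as \<open>\<delta> \<longlongrightarrow> 0\<close>, and is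
  bounded away from \<open>1\<close> where \<open>Re Y > \<rho>\<close> if \<open>\<delta> = exp (- b * \<rho>)\<close>. The stopping identity turns this into a bound,
  uniform in \<open>T\<close>, for the probability that the stopped path is farther out than \<open>exp \<rho>\<close>. A path that never exits
  coincides with the stopped path, and \<open>B T\<close> is unlikely to be within \<open>exp \<rho>\<close> for large \<open>T\<close>.
\<close>

lemma AE_exits_strip:
  assumes z: "z = 1" and ab: "\<alpha> < 0" "0 < \<beta>"
  shows "AE \<omega> in M. \<exists>t\<ge>0. bm_log \<omega> t \<notin> log_strip \<alpha> \<beta>"
proof -
  obtain W where W: "\<And>T. W T \<in> borel_measurable M"
    "AE \<omega> in M. \<forall>T. W T \<omega> = bm_log \<omega> (exit_before (log_strip \<alpha> \<beta>) (bm_log \<omega>) (real T))"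
    "\<And>T h. 0 < T \<Longrightarrow> bounded_strip_harmonic \<alpha> \<beta> h \<Longrightarrow> expectation (\<lambda>\<omega>. h (W T \<omega>)) = h 0"
    using stopped_log_harmonic[OF z ab] by blast
  note [measurable] = W(1)
  define b where "b = pi / (2 * (\<beta> - \<alpha>))"
  define \<phi> where "\<phi> = (\<alpha> + \<beta>) / 2"
  have b: "b > 0" using ab by (simp add: b_def)
  define G where "G \<delta> Y = exp (- of_real \<delta> * exp (of_real b * (Y - \<i> * of_real \<phi>)))" for \<delta> :: real and Y :: complex
  have G_bound: "\<bar>Re (G \<delta> Y)\<bar> \<le> exp (- (\<delta> * exp (b * Re Y) / 2))"
    if "0 \<le> \<delta>" "Im Y \<in> {\<alpha>..\<beta>}" for \<delta> Y
  proof -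
    have "\<bar>Im Y - \<phi>\<bar> \<le> (\<beta> - \<alpha>) / 2" using that ab by (auto simp: \<phi>_def abs_le_iff field_simps)
    hence "b * \<bar>Im Y - \<phi>\<bar> \<le> b * ((\<beta> - \<alpha>) / 2)" using b by (intro mult_left_mono) auto
    also have "b * ((\<beta> - \<alpha>) / 2) = pi / 4"
    proof -
      have "pi / (2 * k) * (k / 2) = pi / 4" if "k \<noteq> 0" for k :: real using that by (simp add: field_simps)
      thus ?thesis using ab unfolding b_def by (metis less_irrefl less_trans right_minus_eq)
    qed
    finally have *: "\<bar>b * (Im Y - \<phi>)\<bar> \<le> pi / 4" using b unfolding abs_mult by linarith
    have "1 / 2 \<le> cos (pi / 4)" by (simp add: cos_45 real_le_rsqrt)
    also have "\<dots> \<le> cos \<bar>b * (Im Y - \<phi>)\<bar>" using * by (intro cos_monotone_0_pi_le) auto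
    finally have c: "1 / 2 \<le> cos (b * (Im Y - \<phi>))" by simp
    have "\<bar>Re (G \<delta> Y)\<bar> \<le> norm (G \<delta> Y)" by (rule abs_Re_le_cmod)
    also have "\<dots> = exp (- (\<delta> * (exp (b * Re Y) * cos (b * (Im Y - \<phi>)))))"
      by (simp add: G_def Re_exp)
    also have "\<dots> \<le> exp (- (\<delta> * (exp (b * Re Y) * (1 / 2))))"
      using mult_left_mono[OF mult_left_mono[OF c, of "exp (b * Re Y)"] that(1)] by simp
    finally show ?thesis by simp
  qed
  define \<eta> where "\<eta> \<rho> = (1 - Re (G (exp (- b * \<rho>)) 0)) / (1 - exp (- 1 / 2))" for \<rho> :: real
  have far: "prob {\<omega> \<in> space M. \<rho> < Re (W T \<omega>)} \<le> \<eta> \<rho>" if T: "0 < T" for T \<rho>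
  proof -
    define \<delta> where "\<delta> = exp (- b * \<rho>)"
    have G_cont: "continuous_on A (\<lambda>Y. Re (G \<delta> Y))" for A
      unfolding G_def by (intro continuous_intros)
    have Gm[measurable]: "(\<lambda>Y. Re (G \<delta> Y)) \<in> borel_measurable borel"
      using G_cont by (rule borel_measurable_continuous_onI)
    have le1: "\<bar>Re (G \<delta> Y)\<bar> \<le> 1" if "Im Y \<in> {\<alpha>..\<beta>}" for Y
      using G_bound[OF _ that, of \<delta>] by (rule order_trans) (auto simp: \<delta>_def)
    have EG: "expectation (\<lambda>\<omega>. Re (G \<delta> (W T \<omega>))) = Re (G \<delta> 0)"
    proof (rule W(3)[OF T], rule bounded_strip_harmonicI[OF Gm _ refl G_cont le1])
      show "G \<delta> holomorphic_on log_strip \<alpha> \<beta>"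
        unfolding G_def[abs_def] by (intro holomorphic_intros)
    qed auto
    let ?I = "indicat_real {\<omega> \<in> space M. \<rho> < Re (W T \<omega>)}"
    have pt: "AE \<omega> in M. \<bar>Re (G \<delta> (W T \<omega>))\<bar> \<le> 1 \<and> Re (G \<delta> (W T \<omega>)) \<le> 1 - (1 - exp (- 1 / 2)) * ?I \<omega>"
      using W(2) AE_is_log_path[OF z]
    proof eventually_elim
      case (elim \<omega>)
      have Im: "Im (W T \<omega>) \<in> {\<alpha>..\<beta>}"
        using elim exit_before_strip_closure[OF _ _ _ ab, of "bm_log \<omega>" "real T"] by (auto simp: is_log_path_def)
      have "Re (G \<delta> (W T \<omega>)) \<le> exp (- 1 / 2)" if "\<rho> < Re (W T \<omega>)"
      proof -
        have "\<bar>Re (G \<delta> (W T \<omega>))\<bar> \<le> exp (- (\<delta> * exp (b * Re (W T \<omega>)) / 2))"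
          by (rule G_bound[OF _ Im]) (simp add: \<delta>_def)
        also have "\<dots> = exp (- (exp (b * (Re (W T \<omega>) - \<rho>)) / 2))"
          by (simp add: \<delta>_def exp_add[symmetric] algebra_simps)
        also have "\<dots> \<le> exp (- 1 / 2)" using that b by simp
        finally show ?thesis by simp
      qed
      thus ?case using le1[OF Im] by (auto simp: indicator_def)
    qed
    have int: "integrable M (\<lambda>\<omega>. Re (G \<delta> (W T \<omega>)))"
      using pt by (intro integrable_const_bound[of _ 1]) auto
    have intI: "integrable M ?I" by (simp add: less_top[symmetric])
    have "Re (G \<delta> 0) \<le> expectation (\<lambda>\<omega>. 1 - (1 - exp (- 1 / 2)) * ?I \<omega>)"
      unfolding EG[symmetric] using pt intI by (intro integral_mono_AE int) auto
    also have "\<dots> = 1 - (1 - exp (- 1 / 2)) * prob {\<omega> \<in> space M. \<rho> < Re (W T \<omega>)}"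
      using intI by (simp add: prob_space)
    finally have "(1 - exp (- 1 / 2)) * prob {\<omega> \<in> space M. \<rho> < Re (W T \<omega>)} \<le> 1 - Re (G \<delta> 0)" by simp
    moreover have "1 - exp (- 1 / 2 :: real) > 0" by simp
    ultimately show ?thesis by (simp add: \<eta>_def \<delta>_def pos_le_divide_eq mult.commute)
  qed
  have \<eta>_lim: "(\<lambda>k. \<eta> (real k)) \<longlonglongrightarrow> 0"
  proof -
    have "(\<lambda>k. exp (- b * real k)) \<longlonglongrightarrow> 0" using b by real_asymp
    hence "(\<lambda>k. \<eta> (real k)) \<longlonglongrightarrow> (1 - Re (exp (- of_real 0 * exp (of_real b * (0 - \<i> * of_real \<phi>))))) / (1 - exp (- 1 / 2))"
      unfolding \<eta>_def G_def by (intro tendsto_intros) auto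
    thus ?thesis by simp
  qed
  have "\<exists>T>0. 4 * (exp (real k) + 1)\<^sup>2 / real T \<le> 1 / real (Suc k)" for k
  proof -
    obtain T :: nat where T: "4 * (exp (real k) + 1)\<^sup>2 * real (Suc k) < real T"
      using reals_Archimedean2 by blast
    have "0 < 4 * (exp (real k) + 1)\<^sup>2 * real (Suc k)"
      by (intro mult_pos_pos zero_less_power add_pos_pos) auto
    hence "0 < real T" using T by linarith
    thus ?thesis using T by (intro exI[of _ T]) (auto simp: field_simps)
  qed
  then obtain T where T: "\<And>k. 0 < T k" "\<And>k. 4 * (exp (real k) + 1)\<^sup>2 / real (T k) \<le> 1 / real (Suc k)"
    by metis
  define E1 where "E1 k = {\<omega> \<in> space M. real k < Re (W (T k) \<omega>)}" for k
  define E2 where "E2 k = {\<omega> \<in> space M. norm (B (real (T k)) \<omega>) \<le> exp (real k)}" for k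
  have [measurable]: "B (real (T k)) \<in> borel_measurable M" for k by (intro measurable_B) auto
  have [measurable]: "E1 k \<in> events" "E2 k \<in> events" for k by (auto simp: E1_def E2_def)
  \<comment> \<open>a measurable null set that contains all paths which never exit\<close>
  define N where "N = (\<Inter>k. E1 k \<union> E2 k)"
  have N[measurable]: "N \<in> events" unfolding N_def by measurable
  have Nle: "prob N \<le> \<eta> (real k) + 1 / real (Suc k)" for k
  proof -
    have "prob N \<le> prob (E1 k \<union> E2 k)" by (rule finite_measure_mono) (auto simp: N_def)
    also have "\<dots> \<le> prob (E1 k) + prob (E2 k)" by (rule measure_Un_le) auto
    also have "prob (E1 k) \<le> \<eta> (real k)" unfolding E1_def by (rule far[OF T(1)])
    also have "prob (E2 k) \<le> 1 / real (Suc k)"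
      using prob_near_origin_le[OF z, of "real (T k)" "exp (real k)"] T[of k] by (simp add: E2_def)
    finally show ?thesis by simp
  qed
  have "(\<lambda>k. \<eta> (real k) + 1 / real (Suc k)) \<longlonglongrightarrow> 0 + 0"
    by (intro tendsto_add \<eta>_lim) real_asymp
  hence "prob N \<le> 0 + 0" by (rule LIMSEQ_le_const) (use Nle in blast)
  hence "prob N = 0" using measure_nonneg[of M N] by simp
  hence "AE \<omega> in M. \<omega> \<notin> N" by (simp add: prob_eq_0)
  with W(2) AE_is_log_path[OF z] AE_space show ?thesis
  proof eventually_elim
    case (elim \<omega>)
    show ?case
    proof (rule ccontr)
      assume "\<not> ?thesis"
      hence "\<And>t. 0 \<le> t \<Longrightarrow> bm_log \<omega> t \<in> log_strip \<alpha> \<beta>" by blast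
      hence "W k \<omega> = bm_log \<omega> (real k)" for k using elim(1) by (simp add: exit_before_no_exit)
      hence "exp (Re (W k \<omega>)) = norm (B (real k) \<omega>)" for k
        using elim(2) norm_exp_eq_Re[of "bm_log \<omega> (real k)"] by (simp add: is_log_path_def)
      hence "\<omega> \<in> E1 k \<union> E2 k" for k
        using elim(3) exp_le_cancel_iff[of "Re (W (T k) \<omega>)" "real k"]
        unfolding E1_def E2_def by (metis (mono_tags, lifting) Un_iff mem_Collect_eq not_less)
      thus False using elim(4) by (auto simp: N_def)
    qed
  qed
qed

lemma exit_log_harmonic:
  assumes z: "z = 1" and ab: "\<alpha> < 0" "0 < \<beta>"
  obtains W where
    "W \<in> borel_measurable M"
    "AE \<omega> in M. Im (W \<omega>) \<in> {\<alpha>, \<beta>} \<and> is_first_exit_value (log_strip \<alpha> \<beta>) (bm_log \<omega>) (W \<omega>)"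
    "\<And>h. bounded_strip_harmonic \<alpha> \<beta> h \<Longrightarrow> expectation (\<lambda>\<omega>. h (W \<omega>)) = h 0"
proof -
  define S where "S = log_strip \<alpha> \<beta>"
  obtain V where V: "\<And>T. V T \<in> borel_measurable M"
    "AE \<omega> in M. \<forall>T. V T \<omega> = bm_log \<omega> (exit_before S (bm_log \<omega>) (real T))"
    "\<And>T h. 0 < T \<Longrightarrow> bounded_strip_harmonic \<alpha> \<beta> h \<Longrightarrow> expectation (\<lambda>\<omega>. h (V T \<omega>)) = h 0"
    unfolding S_def using stopped_log_harmonic[OF z ab] by blast
  note [measurable] = V(1)
  define W where "W \<omega> = lim (\<lambda>T. V T \<omega>)" for \<omega>
  have Wm[measurable]: "W \<in> borel_measurable M" unfolding W_def by measurable
  have key: "AE \<omega> in M. \<exists>\<tau>\<ge>0. W \<omega> = bm_log \<omega> \<tau> \<and> bm_log \<omega> \<tau> \<notin> S \<and> Im (bm_log \<omega> \<tau>) \<in> {\<alpha>..\<beta>} \<and>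
      (\<forall>t. 0 \<le> t \<longrightarrow> t < \<tau> \<longrightarrow> bm_log \<omega> t \<in> S) \<and> (\<forall>\<^sub>F T in sequentially. V T \<omega> = W \<omega>) \<and> (\<forall>T. Im (V T \<omega>) \<in> {\<alpha>..\<beta>})"
    using V(2) AE_is_log_path[OF z] AE_exits_strip[OF z ab]
  proof eventually_elim
    case (elim \<omega>)
    have L: "continuous_on {0..} (bm_log \<omega>)" "bm_log \<omega> 0 = 0" using elim(2) by (auto simp: is_log_path_def)
    obtain t where t: "0 \<le> t" "bm_log \<omega> t \<notin> S" using elim(3) by (auto simp: S_def)
    obtain \<tau> where \<tau>: "0 \<le> \<tau>" "bm_log \<omega> \<tau> \<notin> S" "\<And>u. 0 \<le> u \<Longrightarrow> u < \<tau> \<Longrightarrow> bm_log \<omega> u \<in> S"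
      "\<And>T. \<tau> \<le> T \<Longrightarrow> exit_before S (bm_log \<omega>) T = \<tau>"
      using first_exit_exists[OF L(1) _ t] open_log_strip unfolding S_def by metis
    have "\<forall>\<^sub>F T in sequentially. \<tau> \<le> real T"
      using filterlim_real_sequentially by (simp add: filterlim_at_top)
    hence ev: "\<forall>\<^sub>F T in sequentially. V T \<omega> = bm_log \<omega> \<tau>"
      by eventually_elim (use elim(1) \<tau>(4) in auto)
    hence "W \<omega> = bm_log \<omega> \<tau>" unfolding W_def by (intro limI tendsto_eventually)
    moreover have "Im (bm_log \<omega> \<tau>) \<in> {\<alpha>..\<beta>}"
      using exit_before_strip_closure[OF L(1) \<tau>(1) L(2) ab] \<tau>(4)[of \<tau>] by (simp add: S_def)
    moreover have "Im (V T \<omega>) \<in> {\<alpha>..\<beta>}" for T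
      using exit_before_strip_closure[OF L(1) _ L(2) ab, of "real T"] elim(1) by (simp add: S_def)
    ultimately show ?case using \<tau>(1-3) ev by (intro exI[of _ \<tau>] conjI) auto
  qed
  show thesis
  proof (rule that)
    show "W \<in> borel_measurable M" by (rule Wm)
    show "AE \<omega> in M. Im (W \<omega>) \<in> {\<alpha>, \<beta>} \<and> is_first_exit_value (log_strip \<alpha> \<beta>) (bm_log \<omega>) (W \<omega>)"
      using key
    proof eventually_elim
      case (elim \<omega>)
      then obtain \<tau> where \<tau>: "\<tau> \<ge> 0" "W \<omega> = bm_log \<omega> \<tau>" "bm_log \<omega> \<tau> \<notin> log_strip \<alpha> \<beta>"
        "Im (bm_log \<omega> \<tau>) \<in> {\<alpha>..\<beta>}" "\<forall>t. 0 \<le> t \<longrightarrow> t < \<tau> \<longrightarrow> bm_log \<omega> t \<in> log_strip \<alpha> \<beta>"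
        unfolding S_def by blast
      have "Im (W \<omega>) \<in> {\<alpha>, \<beta>}" using \<tau>(2-4) by (auto simp: log_strip_def)
      thus ?case using \<tau> unfolding is_first_exit_value_def by metis
    qed
    fix h
    assume harm: "bounded_strip_harmonic \<alpha> \<beta> h"
    then obtain C where h[measurable]: "h \<in> borel_measurable borel"
      and C: "\<And>Y. Im Y \<in> {\<alpha>..\<beta>} \<Longrightarrow> \<bar>h Y\<bar> \<le> C"
      unfolding bounded_strip_harmonic_def by blast
    have "(\<lambda>T. expectation (\<lambda>\<omega>. h (V (Suc T) \<omega>))) \<longlonglongrightarrow> expectation (\<lambda>\<omega>. h (W \<omega>))"
    proof (rule integral_dominated_convergence[where w = "\<lambda>_. C"])
      show "AE \<omega> in M. (\<lambda>T. h (V (Suc T) \<omega>)) \<longlonglongrightarrow> h (W \<omega>)"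
        using key
      proof eventually_elim
        case (elim \<omega>)
        hence "\<forall>\<^sub>F T in sequentially. V T \<omega> = W \<omega>" by blast
        hence "(\<lambda>T. h (V T \<omega>)) \<longlonglongrightarrow> h (W \<omega>)"
          by (intro tendsto_eventually) (auto elim: eventually_mono)
        thus ?case by (rule LIMSEQ_Suc)
      qed
      show "AE \<omega> in M. norm (h (V (Suc T) \<omega>)) \<le> C" for T
        using key by eventually_elim (use C in auto)
    qed auto
    moreover have "expectation (\<lambda>\<omega>. h (V (Suc T) \<omega>)) = h 0" for T
      by (rule V(3)[OF _ harm]) simp
    ultimately show "expectation (\<lambda>\<omega>. h (W \<omega>)) = h 0" by (simp add: LIMSEQ_const_iff)
  qed
qed

end

section \<open>The exit law in the half-plane coordinate\<close>

text \<open>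
  The sign has mean \<open>P (X < a) - P (X > a)\<close>. As this is continuous in \<open>a\<close>, the law of \<open>X\<close> has no atoms, and both
  tails can be read off.
\<close>

lemma (in prob_space) cauchy_tails:
  fixes X :: "'a \<Rightarrow> real"
  assumes X[measurable]: "X \<in> borel_measurable M"
    and sgn: "\<And>a. expectation (\<lambda>\<omega>. sgn (a - X \<omega>)) = 2 / pi * arctan ((a - u) / v)"
    and v: "0 < v"
  shows "prob {\<omega> \<in> space M. X \<omega> \<le> a} = 1 / 2 + arctan ((a - u) / v) / pi"
    and "prob {\<omega> \<in> space M. a \<le> X \<omega>} = 1 / 2 - arctan ((a - u) / v) / pi"
proof -
  define A where "A b = 2 / pi * arctan ((b - u) / v)" for b
  let ?E = "{\<omega> \<in> space M. X \<omega> = a}"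
  have int: "integrable M (\<lambda>\<omega>. sgn (b - X \<omega>))" for b
    by (rule integrable_const_bound[of _ 1]) (auto simp: abs_sgn_eq)
  have intI: "integrable M (indicat_real F)" if "F \<in> events" for F
    using that by (simp add: less_top[symmetric])
  have "2 * prob ?E \<le> A (a + d) - A (a - d)" if "0 < d" for d
  proof -
    have "2 * prob ?E = expectation (\<lambda>\<omega>. 2 * indicator ?E \<omega>)" by simp
    also have "\<dots> \<le> expectation (\<lambda>\<omega>. sgn (a + d - X \<omega>) - sgn (a - d - X \<omega>))"
      using that by (intro integral_mono Bochner_Integration.integrable_diff int integrable_mult_right intI)
         (auto simp: indicator_def sgn_if)
    also have "\<dots> = A (a + d) - A (a - d)"
      by (subst Bochner_Integration.integral_diff[OF int int]) (simp add: sgn A_def)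
    finally show ?thesis .
  qed
  moreover have "(\<lambda>n. A (a + 1 / real (Suc n)) - A (a - 1 / real (Suc n))) \<longlonglongrightarrow> A (a + 0) - A (a - 0)"
    unfolding A_def by (intro tendsto_intros LIMSEQ_Suc[OF lim_1_over_n]) (use v in auto)
  ultimately have "2 * prob ?E \<le> A (a + 0) - A (a - 0)"
    by (intro LIMSEQ_le_const) auto
  hence E0: "prob ?E = 0" using measure_nonneg[of M ?E] by simp
  have "A a = expectation (\<lambda>\<omega>. 2 * indicator {\<omega> \<in> space M. X \<omega> \<le> a} \<omega> - indicator ?E \<omega> - 1)"
    unfolding A_def sgn[symmetric] by (intro Bochner_Integration.integral_cong) (auto simp: indicator_def sgn_if)
  also have "\<dots> = 2 * prob {\<omega> \<in> space M. X \<omega> \<le> a} - prob ?E - 1"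
    using intI[of "{\<omega> \<in> space M. X \<omega> \<le> a}"] intI[of ?E] by (simp add: prob_space)
  finally show "prob {\<omega> \<in> space M. X \<omega> \<le> a} = 1 / 2 + arctan ((a - u) / v) / pi"
    using E0 by (simp add: A_def field_simps)
  have "A a = expectation (\<lambda>\<omega>. 1 + indicator ?E \<omega> - 2 * indicator {\<omega> \<in> space M. a \<le> X \<omega>} \<omega>)"
    unfolding A_def sgn[symmetric] by (intro Bochner_Integration.integral_cong) (auto simp: indicator_def sgn_if)
  also have "\<dots> = 1 + prob ?E - 2 * prob {\<omega> \<in> space M. a \<le> X \<omega>}"
    using intI[of "{\<omega> \<in> space M. a \<le> X \<omega>}"] intI[of ?E] by (simp add: prob_space)
  finally show "prob {\<omega> \<in> space M. a \<le> X \<omega>} = 1 / 2 - arctan ((a - u) / v) / pi"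
    using E0 by (simp add: A_def field_simps)
qed

definition halfplane_map :: "real \<Rightarrow> real \<Rightarrow> complex \<Rightarrow> complex" where
  "halfplane_map \<alpha> \<beta> Y = exp (of_real (pi / (\<beta> - \<alpha>)) * (Y - \<i> * of_real \<alpha>))"

lemma Re_halfplane_map: "Re (halfplane_map \<alpha> \<beta> Y) = exp (pi / (\<beta> - \<alpha>) * Re Y) * cos (pi / (\<beta> - \<alpha>) * (Im Y - \<alpha>))"
  and Im_halfplane_map: "Im (halfplane_map \<alpha> \<beta> Y) = exp (pi / (\<beta> - \<alpha>) * Re Y) * sin (pi / (\<beta> - \<alpha>) * (Im Y - \<alpha>))"
  by (simp_all add: halfplane_map_def Re_exp Im_exp del: of_real_divide of_real_diff)

lemma Im_halfplane_map_nonneg: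
  assumes "\<alpha> < \<beta>" "Im Y \<in> {\<alpha>..\<beta>}"
  shows "0 \<le> Im (halfplane_map \<alpha> \<beta> Y)"
proof -
  have "pi / (\<beta> - \<alpha>) * (Im Y - \<alpha>) \<le> pi / (\<beta> - \<alpha>) * (\<beta> - \<alpha>)" using assms by (intro mult_left_mono) auto
  hence "pi / (\<beta> - \<alpha>) * (Im Y - \<alpha>) \<le> pi" using assms by simp
  moreover have "0 \<le> pi / (\<beta> - \<alpha>) * (Im Y - \<alpha>)" using assms by auto
  ultimately show ?thesis
    unfolding Im_halfplane_map by (intro mult_nonneg_nonneg[OF exp_ge_zero sin_ge_zero])
qed

lemma halfplane_map_boundary:
  assumes "\<alpha> < \<beta>"
  shows "Im Y = \<alpha> \<Longrightarrow> halfplane_map \<alpha> \<beta> Y = of_real (exp (pi / (\<beta> - \<alpha>) * Re Y))"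
    and "Im Y = \<beta> \<Longrightarrow> halfplane_map \<alpha> \<beta> Y = - of_real (exp (pi / (\<beta> - \<alpha>) * Re Y))"
  using assms by (auto simp: complex_eq_iff Re_halfplane_map Im_halfplane_map)

text \<open>
  For \<open>e > 0\<close> the function \<open>arctan ((a - Re w) / (Im w + e))\<close> is the imaginary part of a logarithm, hence harmonic
  above the line \<open>Im w = - e\<close>; it is continuous on the closed half plane, which for \<open>e = 0\<close> would fail at the boundary
  point \<open>a\<close>. On the real line it tends to \<open>pi / 2 * sgn (a - w)\<close> as \<open>e \<longlongrightarrow> 0\<close>.
\<close>

lemma (in planar_brownian_motion) exit_log_tails:
  assumes z: "z = 1" and ab: "\<alpha> < 0" "0 < \<beta>"
  defines "u \<equiv> Re (halfplane_map \<alpha> \<beta> 0)" and "v \<equiv> Im (halfplane_map \<alpha> \<beta> 0)"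
  obtains W where
    "W \<in> borel_measurable M"
    "AE \<omega> in M. Im (W \<omega>) \<in> {\<alpha>, \<beta>} \<and> is_first_exit_value (log_strip \<alpha> \<beta>) (bm_log \<omega>) (W \<omega>)"
    "\<And>a. prob {\<omega> \<in> space M. Re (halfplane_map \<alpha> \<beta> (W \<omega>)) \<le> a} = 1 / 2 + arctan ((a - u) / v) / pi"
    "\<And>a. prob {\<omega> \<in> space M. a \<le> Re (halfplane_map \<alpha> \<beta> (W \<omega>))} = 1 / 2 - arctan ((a - u) / v) / pi"
proof -
  define w where "w = halfplane_map \<alpha> \<beta>"
  obtain W where W: "W \<in> borel_measurable M"
    "AE \<omega> in M. Im (W \<omega>) \<in> {\<alpha>, \<beta>} \<and> is_first_exit_value (log_strip \<alpha> \<beta>) (bm_log \<omega>) (W \<omega>)"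
    "\<And>h. bounded_strip_harmonic \<alpha> \<beta> h \<Longrightarrow> expectation (\<lambda>\<omega>. h (W \<omega>)) = h 0"
    using exit_log_harmonic[OF z ab] by blast
  note [measurable] = W(1)
  have "0 < pi / (\<beta> - \<alpha>) * (Im 0 - \<alpha>)" "pi / (\<beta> - \<alpha>) * (Im 0 - \<alpha>) < pi"
    using ab by (auto simp: field_simps mult_pos_neg)
  hence v: "0 < v" unfolding v_def Im_halfplane_map by (rule mult_pos_pos[OF exp_gt_zero sin_gt_zero])
  have w_holo: "w holomorphic_on A" for A
    unfolding w_def halfplane_map_def by (intro holomorphic_intros)
  have w_cont: "continuous_on A w" for A using w_holo by (rule holomorphic_on_imp_continuous_on)
  have [measurable]: "w \<in> borel_measurable borel" by (rule borel_measurable_continuous_onI[OF w_cont])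
  have Imw: "0 \<le> Im (w Y)" if "Im Y \<in> {\<alpha>..\<beta>}" for Y
    unfolding w_def using that ab by (intro Im_halfplane_map_nonneg) auto
  define X where "X \<omega> = Re (w (W \<omega>))" for \<omega>
  have X[measurable]: "X \<in> borel_measurable M" unfolding X_def by measurable
  have smoothed: "expectation (\<lambda>\<omega>. arctan ((a - X \<omega>) / e)) = arctan ((a - u) / (v + e))" if e: "0 < e" for a e
  proof -
    define h where "h Y = arctan ((a - Re (w Y)) / (Im (w Y) + e))" for Y
    \<comment> \<open>this is \<open>(w - a + \<i> * e) / \<i>\<close>, turned by a quarter so that it lies in the right half plane\<close>
    define V where "V Y = of_real e + \<i> * of_real a - \<i> * w Y" for Y
    have ReV: "0 < Re (V Y)" if "Im Y \<in> {\<alpha>..\<beta>}" for Y using Imw[OF that] e by (simp add: V_def)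
    have "expectation (\<lambda>\<omega>. h (W \<omega>)) = h 0"
    proof (rule W(3), rule bounded_strip_harmonicI)
      show "h \<in> borel_measurable borel" unfolding h_def by measurable
      show "(\<lambda>Y. - \<i> * Ln (V Y)) holomorphic_on log_strip \<alpha> \<beta>"
        unfolding V_def
      proof (intro holomorphic_intros w_holo)
        fix Y assume "Y \<in> log_strip \<alpha> \<beta>"
        hence "Re (V Y) > 0" by (intro ReV) (auto simp: log_strip_def)
        thus "of_real e + \<i> * of_real a - \<i> * w Y \<notin> \<real>\<^sub>\<le>\<^sub>0"
          by (auto simp: V_def complex_nonpos_Reals_iff)
      qed
      fix Y :: complex
      {
        assume "Y \<in> log_strip \<alpha> \<beta>"
        hence "Re (V Y) > 0" by (intro ReV) (auto simp: log_strip_def)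
        moreover from this have "V Y \<noteq> 0" by auto
        ultimately have "Im (Ln (V Y)) = arctan (Im (V Y) / Re (V Y))"
          by (simp add: arg_conv_arctan flip: Arg_eq_Im_Ln)
        thus "h Y = Re (- \<i> * Ln (V Y))" by (simp add: h_def V_def add.commute)
      }
      show "\<bar>h Y\<bar> \<le> pi / 2"
        using arctan_lbound[of "(a - Re (w Y)) / (Im (w Y) + e)"] arctan_ubound[of "(a - Re (w Y)) / (Im (w Y) + e)"]
        by (simp add: h_def)
    next
      show "continuous_on {Y. Im Y \<in> {\<alpha>..\<beta>}} h"
        unfolding h_def by (intro continuous_intros w_cont) (use Imw e in force)
    qed
    moreover have "expectation (\<lambda>\<omega>. h (W \<omega>)) = expectation (\<lambda>\<omega>. arctan ((a - X \<omega>) / e))"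
    proof (intro integral_cong_AE)
      show "AE \<omega> in M. h (W \<omega>) = arctan ((a - X \<omega>) / e)"
        using W(2)
      proof eventually_elim
        case (elim \<omega>)
        hence "Im (w (W \<omega>)) = 0"
          unfolding w_def using halfplane_map_boundary[of \<alpha> \<beta> "W \<omega>"] ab by auto
        thus ?case by (simp add: h_def X_def)
      qed
    qed (auto simp: h_def)
    ultimately show ?thesis by (simp add: h_def u_def v_def w_def)
  qed
  have sgn: "expectation (\<lambda>\<omega>. sgn (a - X \<omega>)) = 2 / pi * arctan ((a - u) / v)" for a
  proof -
    have lim: "(\<lambda>n. arctan (x / (1 / real (Suc n)))) \<longlonglongrightarrow> pi / 2 * sgn x" for x
    proof -
      consider "x = 0" | "x > 0" | "x < 0" by linarith
      thus ?thesis
      proof cases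
        case 2
        hence "filterlim (\<lambda>n. x / (1 / real (Suc n))) at_top sequentially" by real_asymp
        from filterlim_compose[OF tendsto_arctan_at_top this] 2 show ?thesis by simp
      next
        case 3
        hence "filterlim (\<lambda>n. x / (1 / real (Suc n))) at_bot sequentially" by real_asymp
        from filterlim_compose[OF tendsto_arctan_at_bot this] 3 show ?thesis by simp
      qed simp
    qed
    have "(\<lambda>n. expectation (\<lambda>\<omega>. arctan ((a - X \<omega>) / (1 / real (Suc n))))) \<longlonglongrightarrow> expectation (\<lambda>\<omega>. pi / 2 * sgn (a - X \<omega>))"
    proof (rule integral_dominated_convergence[where w = "\<lambda>_. pi / 2"])
      show "AE \<omega> in M. (\<lambda>n. arctan ((a - X \<omega>) / (1 / real (Suc n)))) \<longlonglongrightarrow> pi / 2 * sgn (a - X \<omega>)"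
        using lim by blast
      have "\<bar>arctan x\<bar> \<le> pi / 2" for x
        using arctan_lbound[of x] arctan_ubound[of x] by linarith
      thus "AE \<omega> in M. norm (arctan ((a - X \<omega>) / (1 / real (Suc n)))) \<le> pi / 2" for n
        unfolding real_norm_def by blast
    qed auto
    hence "(\<lambda>n. arctan ((a - u) / (v + 1 / real (Suc n)))) \<longlonglongrightarrow> expectation (\<lambda>\<omega>. pi / 2 * sgn (a - X \<omega>))"
      by (subst (asm) smoothed) simp_all
    moreover have "(\<lambda>n. arctan ((a - u) / (v + 1 / real (Suc n)))) \<longlonglongrightarrow> arctan ((a - u) / (v + 0))"
      by (intro tendsto_intros LIMSEQ_Suc[OF lim_1_over_n]) (use v in auto)
    ultimately have "expectation (\<lambda>\<omega>. pi / 2 * sgn (a - X \<omega>)) = arctan ((a - u) / (v + 0))"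
      by (rule LIMSEQ_unique)
    thus ?thesis by (simp add: field_simps)
  qed
  show thesis
    by (rule that[OF W(1,2)]) (use cauchy_tails[OF X sgn v] in \<open>simp_all add: X_def w_def\<close>)
qed

section \<open>Densities on the rays\<close>

text \<open>
  Only the tails \<open>{y..}\<close> with \<open>y > 0\<close> are compared, because \<open>p\<close> may be unbounded near \<open>0\<close>, where \<open>F\<close> need not
  be differentiable; the rest follows by continuity from below.
\<close>

lemma measure_eq_density_from_tails:
  fixes N :: "real measure"
  assumes "finite_measure N" and sets[simp, measurable_cong]: "sets N = sets borel"
    and null: "emeasure N {..0} = 0"
    and p[measurable]: "p \<in> borel_measurable borel" and nonneg: "\<And>y. 0 < y \<Longrightarrow> 0 \<le> p y"
    and F: "\<And>y. 0 < y \<Longrightarrow> (F has_real_derivative - p y) (at y)" and lim: "(F \<longlongrightarrow> 0) at_top"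
    and tail: "\<And>y. 0 < y \<Longrightarrow> emeasure N {y..} = ennreal (F y)"
  shows "N = density lborel (\<lambda>y. ennreal (p y) * indicator {0<..} y)"
proof -
  interpret N: finite_measure N by fact
  define D where "D = density lborel (\<lambda>y. ennreal (p y) * indicator {0<..} y)"
  have D_null: "emeasure D {..0} = 0"
    unfolding D_def by (subst emeasure_density) (auto intro!: nn_integral_zero' AE_I2 split: split_indicator)
  have D_tail: "emeasure D {y..} = ennreal (F y)" if y: "0 < y" for y
  proof -
    have "emeasure D {y..} = (\<integral>\<^sup>+x. ennreal (p x) * indicator {y..} x \<partial>lborel)"
      unfolding D_def using y by (subst emeasure_density) (auto intro!: nn_integral_cong split: split_indicator)
    also have "\<dots> = ennreal (0 - - F y)"
      using y nonneg by (subst nn_integral_FTC_atLeast[of p y "\<lambda>y. - F y" 0])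
        (auto intro!: derivative_eq_intros F tendsto_eq_intros lim)
    finally show ?thesis by simp
  qed
  have open_tail: "emeasure R {x<..} = (SUP n. ennreal (F (max x 0 + 1 / real (Suc n))))"
    if R: "sets R = sets borel" "emeasure R {..0} = 0" "\<And>y. 0 < y \<Longrightarrow> emeasure R {y..} = ennreal (F y)" for R x
  proof -
    have [measurable_cong]: "sets R = sets borel" by fact
    define x0 where "x0 = max x 0"
    have U: "(\<Union>n. {x0 + 1 / real (Suc n)..}) = {x0<..}"
    proof safe
      fix y assume "x0 < y"
      then obtain n where "1 / real (Suc n) < y - x0"
        using reals_Archimedean[of "y - x0"] by (auto simp: inverse_eq_divide)
      thus "y \<in> (\<Union>n. {x0 + 1 / real (Suc n)..})" by (intro UN_I[of n]) auto
    next
      fix n y assume "x0 + 1 / real (Suc n) \<le> y"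
      moreover have "0 < 1 / real (Suc n)" by simp
      ultimately show "x0 < y" by linarith
    qed
    have "emeasure R {x<..} = emeasure R {x0<..}"
    proof (rule emeasure_eq_AE)
      have "AE y in R. y \<notin> {..0}" using R(1,2) by (intro AE_not_in null_setsI) auto
      thus "AE y in R. (y \<in> {x<..}) = (y \<in> {x0<..})" by eventually_elim (auto simp: x0_def)
    qed (auto simp: R(1))
    also have "\<dots> = (SUP n. emeasure R {x0 + 1 / real (Suc n)..})"
      unfolding U[symmetric]
      by (rule SUP_emeasure_incseq[symmetric]) (auto simp: R(1) incseq_def intro: order_trans[rotated] divide_left_mono)
    also have "\<dots> = (SUP n. ennreal (F (x0 + 1 / real (Suc n))))"
      by (intro SUP_cong refl R(3)) (auto simp: x0_def max_def add_nonneg_pos)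
    finally show ?thesis by (simp add: x0_def)
  qed
  have "N = D"
  proof (rule measure_eqI_lessThan)
    show "emeasure N {x<..} = emeasure D {x<..}" for x
      using open_tail[OF sets null tail, of x] open_tail[OF _ D_null D_tail, of x] by (simp add: D_def)
    show "emeasure N {x<..} < \<infinity>" for x using N.emeasure_finite by (simp add: less_top[symmetric])
  qed (auto simp: D_def)
  thus ?thesis by (simp add: D_def)
qed

lemma nn_integral_ray_arclength:
  assumes U: "finite U" and g[measurable]: "g \<in> borel_measurable borel"
  shows "(\<integral>\<^sup>+z. g z \<partial>ray_arclength U) = (\<Sum>u\<in>U. \<integral>\<^sup>+y. g (y *\<^sub>R u) * indicator {0<..} y \<partial>lborel)"
proof -
  define R where "R = restrict_space lborel {0::real<..}"
  have sets_R[measurable_cong]: "sets R = sets (restrict_space borel {0<..})"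
    unfolding R_def by (rule sets_restrict_space_cong) simp
  have [measurable]: "(\<lambda>y. y) \<in> borel_measurable R"
    unfolding R_def by (intro measurable_restrict_space1) simp
  interpret R: sigma_finite_measure R
    unfolding R_def by (rule sigma_finite_measure_restrict_space) (auto intro: lborel.sigma_finite_measure_axioms)
  have [measurable]: "(\<lambda>(u, y). y *\<^sub>R u) \<in> borel_measurable (count_space U \<Otimes>\<^sub>M R)"
  proof -
    have "(\<lambda>p. snd p *\<^sub>R fst p) \<in> borel_measurable (count_space U \<Otimes>\<^sub>M R)"
    proof (rule borel_measurable_scaleR)
      show "snd \<in> borel_measurable (count_space U \<Otimes>\<^sub>M R)"
        using measurable_compose[OF measurable_snd, of "\<lambda>y. y" R borel] by simp
      show "fst \<in> borel_measurable (count_space U \<Otimes>\<^sub>M R)"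
        using measurable_compose[OF measurable_fst, of "\<lambda>u. u" "count_space U" borel] by simp
    qed
    thus ?thesis by (simp add: case_prod_beta')
  qed
  have "(\<integral>\<^sup>+z. g z \<partial>ray_arclength U) = (\<integral>\<^sup>+p. g (snd p *\<^sub>R fst p) \<partial>(count_space U \<Otimes>\<^sub>M R))"
    unfolding ray_arclength_def R_def[symmetric] by (subst nn_integral_distr) (auto simp: case_prod_beta')
  also have "\<dots> = (\<integral>\<^sup>+u. \<integral>\<^sup>+y. g (y *\<^sub>R u) \<partial>R \<partial>count_space U)"
    by (subst R.nn_integral_fst[symmetric]) (auto simp: case_prod_beta' )
  also have "\<dots> = (\<Sum>u\<in>U. \<integral>\<^sup>+y. g (y *\<^sub>R u) \<partial>R)"
    by (rule nn_integral_count_space_finite[OF U])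
  also have "\<dots> = (\<Sum>u\<in>U. \<integral>\<^sup>+y. g (y *\<^sub>R u) * indicator {0<..} y \<partial>lborel)"
    unfolding R_def by (subst nn_integral_restrict_space) auto
  finally show ?thesis .
qed

lemma le_exp_iff_powr_inverse_le:
  fixes s x y :: real
  assumes "0 < s" "0 < y"
  shows "y \<le> exp x \<longleftrightarrow> y powr (1 / s) \<le> exp (x / s)"
proof -
  have "y \<le> exp x \<longleftrightarrow> ln y \<le> x" using assms exp_le_cancel_iff[of "ln y" x] by simp
  also have "\<dots> \<longleftrightarrow> ln y / s \<le> x / s" using assms by (simp add: divide_le_cancel)
  also have "\<dots> \<longleftrightarrow> y powr (1 / s) \<le> exp (x / s)" using assms by (simp add: powr_def)
  finally show ?thesis .
qed

text \<open>
  A sum rather than a case distinction: if the two rays coincide, the two densities add up on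
  their common ray.
\<close>

definition exit_density :: "complex \<Rightarrow> complex \<Rightarrow> (real \<Rightarrow> real) \<Rightarrow> (real \<Rightarrow> real) \<Rightarrow> complex \<Rightarrow> ennreal" where
  "exit_density u v p q z =
     (if z = norm z *\<^sub>R u then ennreal (p (norm z)) else 0) +
     (if z = norm z *\<^sub>R v then ennreal (q (norm z)) else 0)"

lemma measurable_exit_density [measurable]:
  assumes [measurable]: "p \<in> borel_measurable borel" "q \<in> borel_measurable borel"
  shows "exit_density u v p q \<in> borel_measurable borel"
  unfolding exit_density_def by measurable

lemma exit_density_on_ray:
  assumes "0 < y" "norm u = 1" "norm v = 1" "norm w = 1"
  shows "exit_density u v p q (y *\<^sub>R w) =
    (if w = u then ennreal (p y) else 0) + (if w = v then ennreal (q y) else 0)"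
  using assms by (simp add: exit_density_def)

lemma density_ray_arclength:
  assumes [measurable]: "p \<in> borel_measurable borel" "q \<in> borel_measurable borel" "E \<in> sets borel"
    and uv: "norm u = 1" "norm v = 1"
  shows "emeasure (density (ray_arclength {u, v}) (exit_density u v p q)) E =
    emeasure (density lborel (\<lambda>y. ennreal (p y) * indicator {0<..} y)) {y. y *\<^sub>R u \<in> E} +
    emeasure (density lborel (\<lambda>y. ennreal (q y) * indicator {0<..} y)) {y. y *\<^sub>R v \<in> E}"
proof -
  define J where "J p w = (\<integral>\<^sup>+y. ennreal (p y) * indicator {0<..} y * indicator E (y *\<^sub>R w) \<partial>lborel)"
    for p :: "real \<Rightarrow> real" and w
  have [measurable]: "{y. y *\<^sub>R w \<in> E} \<in> sets borel" for w :: complex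
    using measurable_sets[of "\<lambda>y. y *\<^sub>R w" borel borel E] by (simp add: vimage_def)
  have dens: "emeasure (density lborel (\<lambda>y. ennreal (p y) * indicator {0<..} y)) {y. y *\<^sub>R w \<in> E} = J p w"
    if [measurable]: "p \<in> borel_measurable borel" for p w
    unfolding J_def by (subst emeasure_density) (auto intro!: nn_integral_cong simp: indicator_def)
  have ray: "(\<integral>\<^sup>+y. exit_density u v p q (y *\<^sub>R w) * indicator E (y *\<^sub>R w) * indicator {0<..} y \<partial>lborel) =
      (if w = u then J p w else 0) + (if w = v then J q w else 0)" if "norm w = 1" for w
  proof -
    have "(\<integral>\<^sup>+y. exit_density u v p q (y *\<^sub>R w) * indicator E (y *\<^sub>R w) * indicator {0<..} y \<partial>lborel) =
        (\<integral>\<^sup>+y. (if w = u then ennreal (p y) * indicator {0<..} y * indicator E (y *\<^sub>R w) else 0) +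
              (if w = v then ennreal (q y) * indicator {0<..} y * indicator E (y *\<^sub>R w) else 0) \<partial>lborel)"
      using exit_density_on_ray[OF _ uv that] by (intro nn_integral_cong) (auto simp: indicator_def)
    also have "\<dots> = (if w = u then J p w else 0) + (if w = v then J q w else 0)"
      unfolding J_def by (subst nn_integral_add) auto
    finally show ?thesis .
  qed
  have "emeasure (density (ray_arclength {u, v}) (exit_density u v p q)) E =
      (\<integral>\<^sup>+z. exit_density u v p q z * indicator E z \<partial>ray_arclength {u, v})"
    by (rule emeasure_density) (auto simp: ray_arclength_def)
  also have "\<dots> = (\<Sum>w\<in>{u, v}. (if w = u then J p w else 0) + (if w = v then J q w else 0))"
    using uv by (subst nn_integral_ray_arclength) (auto intro!: sum.cong ray)
  also have "\<dots> = J p u + J q v" by (cases "u = v") (auto simp: add.commute)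
  finally show ?thesis by (simp add: dens)
qed


lemma cos_exit_theta_pos:
  assumes "0 < r1" "0 < r2"
  shows "0 < cos (exit_theta r1 r2)"
proof -
  define q where "q = (r2 - r1) / (r2 + r1)"
  have q: "\<bar>q\<bar> < 1" using assms by (auto simp: q_def abs_if field_simps)
  have "\<bar>exit_theta r1 r2\<bar> = pi / 2 * \<bar>q\<bar>" by (simp add: exit_theta_def q_def[symmetric] abs_mult)
  also have "\<dots> < pi / 2" using mult_strict_left_mono[OF q, of "pi / 2"] by simp
  finally have "\<bar>exit_theta r1 r2\<bar> < pi / 2" .
  thus ?thesis by (intro cos_gt_zero_pi) auto
qed

lemma halfplane_map_0:
  assumes "0 < r1" "0 < r2"
  shows "Re (halfplane_map (- r2 * pi) (r1 * pi) 0) = - sin (exit_theta r1 r2)"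
    and "Im (halfplane_map (- r2 * pi) (r1 * pi) 0) = cos (exit_theta r1 r2)"
proof -
  have "r1 * pi - - r2 * pi = (r1 + r2) * pi" by (simp add: algebra_simps)
  hence "pi / (r1 * pi - - r2 * pi) * (0 - - r2 * pi) = r2 * pi / (r1 + r2)" by simp
  also have "\<dots> = exit_theta r1 r2 + pi / 2"
  proof -
    have "r1 + r2 \<noteq> 0" using assms by simp
    thus ?thesis unfolding exit_theta_def by (simp add: field_simps)
  qed
  finally have "pi / (r1 * pi - - r2 * pi) * (0 - - r2 * pi) = exit_theta r1 r2 + pi / 2" .
  thus "Re (halfplane_map (- r2 * pi) (r1 * pi) 0) = - sin (exit_theta r1 r2)"
    and "Im (halfplane_map (- r2 * pi) (r1 * pi) 0) = cos (exit_theta r1 r2)"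
    unfolding Re_halfplane_map Im_halfplane_map by (simp_all add: sin_add cos_add)
qed

lemma arctan_tail_derivative:
  fixes y s c d :: real
  assumes "0 < y" "0 < s" "0 < c"
  shows "((\<lambda>y. 1 / 2 - arctan ((y powr (1 / s) + d) / c) / pi) has_real_derivative
     - (c / (pi * s * y powr (1 - 1 / s) * (c\<^sup>2 + (y powr (1 / s) + d)\<^sup>2)))) (at y)"
proof -
  define a where "a = y powr (1 / s) + d"
  have 1: "y powr (1 / s - 1) = 1 / y powr (1 - 1 / s)"
    using powr_minus_divide[of y "1 - 1 / s"] by simp
  have 2: "inverse (1 + (a / c)\<^sup>2) = c\<^sup>2 / (c\<^sup>2 + a\<^sup>2)"
    using assms by (simp add: field_simps)
  have pos: "c\<^sup>2 + a\<^sup>2 > 0" using assms by (intro add_pos_nonneg) auto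
  have "((\<lambda>y. (y powr (1 / s) + d) / c) has_real_derivative 1 / s * y powr (1 / s - 1) / c) (at y)"
    using assms by (auto intro!: derivative_eq_intros)
  from DERIV_cdivide[OF DERIV_chain2[OF DERIV_arctan this], of pi]
  have "((\<lambda>y. 1 / 2 - arctan ((y powr (1 / s) + d) / c) / pi) has_real_derivative
     0 - inverse (1 + (a / c)\<^sup>2) * (1 / s * y powr (1 / s - 1) / c) / pi) (at y)"
    unfolding a_def by (intro DERIV_diff DERIV_const)
  also have "0 - inverse (1 + (a / c)\<^sup>2) * (1 / s * y powr (1 / s - 1) / c) / pi =
      - (c / (pi * s * y powr (1 - 1 / s) * (c\<^sup>2 + a\<^sup>2)))"
  proof -
    have "0 - c\<^sup>2 / Q * (1 / s * (1 / P) / c) / pi = - (c / (pi * s * P * Q))" if "0 < P" "0 < Q" for P Q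
      using that assms by (simp add: field_simps power2_eq_square)
    thus ?thesis unfolding 1 2 using assms pos by simp
  qed
  finally show ?thesis by (simp add: a_def)
qed

lemma arctan_tail_limit:
  fixes s c d :: real
  assumes "0 < s" "0 < c"
  shows "((\<lambda>y. 1 / 2 - arctan ((y powr (1 / s) + d) / c) / pi) \<longlongrightarrow> 0) at_top"
proof -
  have "filterlim (\<lambda>y. (y powr (1 / s) + d) / c) at_top at_top" using assms by real_asymp
  from filterlim_compose[OF tendsto_arctan_at_top this]
  have "((\<lambda>y. 1 / 2 - arctan ((y powr (1 / s) + d) / c) / pi) \<longlongrightarrow> 1 / 2 - (pi / 2) / pi) at_top"
    by (intro tendsto_intros) auto
  thus ?thesis by simp
qed

text \<open>
  On the upper boundary line of the strip the half-plane coordinate of \<open>W\<close> is \<open>- \<bar>exp W\<bar> powr (1 / (r1 + r2))\<close>,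
  on the lower one it is \<open>\<bar>exp W\<bar> powr (1 / (r1 + r2))\<close>. Thus the radial tail on each ray is a tail of the
  Cauchy law in the half-plane coordinate, and the measures \<open>N \<phi>\<close> of the radius on the two rays are found from their tails.
\<close>

lemma (in prob_space) exit_law:
  fixes W :: "'a \<Rightarrow> complex" and r1 r2 :: real
  defines "\<alpha> \<equiv> - r2 * pi" and "\<beta> \<equiv> r1 * pi"
  assumes r: "0 < r1" "0 < r2" and W[measurable]: "W \<in> borel_measurable M"
    and bdry: "AE \<omega> in M. Im (W \<omega>) \<in> {\<alpha>, \<beta>}"
    and lower: "\<And>a. prob {\<omega> \<in> space M. Re (halfplane_map \<alpha> \<beta> (W \<omega>)) \<le> a} =
        1 / 2 + arctan ((a + sin (exit_theta r1 r2)) / cos (exit_theta r1 r2)) / pi"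
    and upper: "\<And>a. prob {\<omega> \<in> space M. a \<le> Re (halfplane_map \<alpha> \<beta> (W \<omega>))} =
        1 / 2 - arctan ((a + sin (exit_theta r1 r2)) / cos (exit_theta r1 r2)) / pi"
  shows "distr M borel (\<lambda>\<omega>. exp (W \<omega>)) = density (ray_arclength {cis \<beta>, cis \<alpha>})
    (exit_density (cis \<beta>) (cis \<alpha>) (p_plus r1 r2) (p_minus r1 r2))"
proof (rule measure_eqI)
  define s where "s = r1 + r2"
  define \<theta> where "\<theta> = exit_theta r1 r2"
  define c where "c = cos \<theta>"
  have s: "0 < s" using r by (simp add: s_def)
  have c: "0 < c" unfolding c_def \<theta>_def by (rule cos_exit_theta_pos[OF r])
  have ab: "\<alpha> < 0" "0 < \<beta>" using r by (auto simp: \<alpha>_def \<beta>_def)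
  have scale: "pi / (\<beta> - \<alpha>) = 1 / s"
  proof -
    have "\<beta> - \<alpha> = s * pi" by (simp add: \<alpha>_def \<beta>_def s_def algebra_simps)
    thus ?thesis by simp
  qed
  have [measurable]: "exp \<in> borel_measurable (borel :: complex measure)"
    by (intro borel_measurable_continuous_onI continuous_intros)
  have [measurable]: "p_plus r1 r2 \<in> borel_measurable borel" "p_minus r1 r2 \<in> borel_measurable borel"
    unfolding p_plus_def[abs_def] p_minus_def[abs_def] Let_def by measurable
  define N where "N \<phi> = distr (density M (indicator {\<omega> \<in> space M. Im (W \<omega>) = \<phi>})) borel (\<lambda>\<omega>. exp (Re (W \<omega>)))" for \<phi>
  have N: "emeasure (N \<phi>) A = emeasure M {\<omega> \<in> space M. Im (W \<omega>) = \<phi> \<and> exp (Re (W \<omega>)) \<in> A}"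
    if [measurable]: "A \<in> sets borel" for \<phi> A
    unfolding N_def
    by (subst emeasure_distr, simp, simp, subst emeasure_density)
       (auto simp: indicator_inter_arith[symmetric] intro!: arg_cong[where f = "emeasure M"])
  have N_finite: "finite_measure (N \<phi>)" for \<phi>
    by (rule finite_measureI) (use N[of UNIV \<phi>] in \<open>simp add: N_def\<close>)
  have N_null: "emeasure (N \<phi>) {..0} = 0" for \<phi> by (subst N) (simp_all add: not_le)
  have sets_N: "sets (N \<phi>) = sets borel" for \<phi> by (simp add: N_def)
  have Re_map: "Re (halfplane_map \<alpha> \<beta> Y) = (if Im Y = \<beta> then - exp (Re Y / s) else exp (Re Y / s))"
    if "Im Y \<in> {\<alpha>, \<beta>}" for Y
    using that halfplane_map_boundary[of \<alpha> \<beta> Y] ab by (auto simp: scale)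
  have tail_plus: "emeasure (N \<beta>) {y..} = ennreal (1 / 2 - arctan ((y powr (1 / s) + - sin \<theta>) / c) / pi)" if y: "0 < y" for y
  proof -
    have "emeasure (N \<beta>) {y..} = emeasure M {\<omega> \<in> space M. Re (halfplane_map \<alpha> \<beta> (W \<omega>)) \<le> - (y powr (1 / s))}"
    proof (subst N, simp, rule emeasure_eq_AE)
      show "AE \<omega> in M. (\<omega> \<in> {\<omega> \<in> space M. Im (W \<omega>) = \<beta> \<and> exp (Re (W \<omega>)) \<in> {y..}}) =
          (\<omega> \<in> {\<omega> \<in> space M. Re (halfplane_map \<alpha> \<beta> (W \<omega>)) \<le> - (y powr (1 / s))})"
        using bdry
      proof eventually_elim
        case (elim \<omega>)
        have "\<not> exp (Re (W \<omega>) / s) \<le> - (y powr (1 / s))"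
          using exp_gt_zero[of "Re (W \<omega>) / s"] powr_ge_zero[of y "1 / s"] by linarith
        thus ?case using Re_map[OF elim] le_exp_iff_powr_inverse_le[OF s y, of "Re (W \<omega>)"] by auto
      qed
    qed (auto simp: halfplane_map_def)
    also have "\<dots> = ennreal (1 / 2 + arctan ((- (y powr (1 / s)) + sin \<theta>) / c) / pi)"
      by (simp add: emeasure_eq_measure lower c_def \<theta>_def)
    also have "(- (y powr (1 / s)) + sin \<theta>) / c = - ((y powr (1 / s) + - sin \<theta>) / c)"
      by (simp add: minus_divide_left)
    finally show ?thesis unfolding arctan_minus by simp
  qed
  have tail_minus: "emeasure (N \<alpha>) {y..} = ennreal (1 / 2 - arctan ((y powr (1 / s) + sin \<theta>) / c) / pi)" if y: "0 < y" for y
  proof -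
    have "emeasure (N \<alpha>) {y..} = emeasure M {\<omega> \<in> space M. y powr (1 / s) \<le> Re (halfplane_map \<alpha> \<beta> (W \<omega>))}"
    proof (subst N, simp, rule emeasure_eq_AE)
      show "AE \<omega> in M. (\<omega> \<in> {\<omega> \<in> space M. Im (W \<omega>) = \<alpha> \<and> exp (Re (W \<omega>)) \<in> {y..}}) =
          (\<omega> \<in> {\<omega> \<in> space M. y powr (1 / s) \<le> Re (halfplane_map \<alpha> \<beta> (W \<omega>))})"
        using bdry
      proof eventually_elim
        case (elim \<omega>)
        have "\<not> y powr (1 / s) \<le> - exp (Re (W \<omega>) / s)"
          using exp_gt_zero[of "Re (W \<omega>) / s"] powr_ge_zero[of y "1 / s"] by linarith
        thus ?case using Re_map[OF elim] le_exp_iff_powr_inverse_le[OF s y, of "Re (W \<omega>)"] elim ab by auto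
      qed
    qed (auto simp: halfplane_map_def)
    thus ?thesis by (simp add: emeasure_eq_measure upper c_def \<theta>_def)
  qed
  have N_plus: "N \<beta> = density lborel (\<lambda>y. ennreal (p_plus r1 r2 y) * indicator {0<..} y)"
  proof (rule measure_eq_density_from_tails[OF N_finite sets_N N_null _ _ _ arctan_tail_limit[OF s c] tail_plus])
    fix y :: real assume y: "0 < y"
    show "0 \<le> p_plus r1 r2 y" using c s by (simp add: p_plus_def Let_def c_def \<theta>_def s_def)
    show "((\<lambda>y. 1 / 2 - arctan ((y powr (1 / s) + - sin \<theta>) / c) / pi) has_real_derivative - p_plus r1 r2 y) (at y)"
      using arctan_tail_derivative[OF y s c, of "- sin \<theta>"] by (simp add: p_plus_def Let_def c_def \<theta>_def s_def)
  qed auto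
  have N_minus: "N \<alpha> = density lborel (\<lambda>y. ennreal (p_minus r1 r2 y) * indicator {0<..} y)"
  proof (rule measure_eq_density_from_tails[OF N_finite sets_N N_null _ _ _ arctan_tail_limit[OF s c] tail_minus])
    fix y :: real assume y: "0 < y"
    show "0 \<le> p_minus r1 r2 y" using c s by (simp add: p_minus_def Let_def c_def \<theta>_def s_def)
    have "(- (y powr (1 / s)) - sin \<theta>)\<^sup>2 = (y powr (1 / s) + sin \<theta>)\<^sup>2" by (simp add: power2_eq_square algebra_simps)
    thus "((\<lambda>y. 1 / 2 - arctan ((y powr (1 / s) + sin \<theta>) / c) / pi) has_real_derivative - p_minus r1 r2 y) (at y)"
      using arctan_tail_derivative[OF y s c, of "sin \<theta>"] by (simp add: p_minus_def Let_def c_def \<theta>_def s_def)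
  qed auto
  fix E assume "E \<in> sets (distr M borel (\<lambda>\<omega>. exp (W \<omega>)))"
  hence E[measurable]: "E \<in> sets borel" by simp
  have ray[measurable]: "{y. y *\<^sub>R w \<in> E} \<in> sets borel" for w :: complex
    using measurable_sets[of "\<lambda>y. y *\<^sub>R w" borel borel E] by (simp add: vimage_def)
  let ?R = "\<lambda>\<phi>. {\<omega> \<in> space M. Im (W \<omega>) = \<phi> \<and> exp (Re (W \<omega>)) *\<^sub>R cis \<phi> \<in> E}"
  have exp_W: "exp (W \<omega>) = exp (Re (W \<omega>)) *\<^sub>R cis (Im (W \<omega>))" for \<omega>
    by (simp add: exp_eq_polar[of "W \<omega>"] scaleR_conv_of_real)
  have "emeasure (distr M borel (\<lambda>\<omega>. exp (W \<omega>))) E = emeasure M (?R \<beta> \<union> ?R \<alpha>)"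
  proof (subst emeasure_distr, simp, simp, rule emeasure_eq_AE)
    show "AE \<omega> in M. (\<omega> \<in> (\<lambda>\<omega>. exp (W \<omega>)) -` E \<inter> space M) = (\<omega> \<in> ?R \<beta> \<union> ?R \<alpha>)"
      using bdry by eventually_elim (auto simp: exp_W)
  qed auto
  also have "\<dots> = emeasure M (?R \<beta>) + emeasure M (?R \<alpha>)"
    using ab by (intro plus_emeasure[symmetric]) auto
  also have "\<dots> = emeasure (N \<beta>) {y. y *\<^sub>R cis \<beta> \<in> E} + emeasure (N \<alpha>) {y. y *\<^sub>R cis \<alpha> \<in> E}"
    by (simp add: N)
  also have "\<dots> = emeasure (density (ray_arclength {cis \<beta>, cis \<alpha>})
      (exit_density (cis \<beta>) (cis \<alpha>) (p_plus r1 r2) (p_minus r1 r2))) E"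
    unfolding N_plus N_minus by (rule density_ray_arclength[symmetric]) auto
  finally show "emeasure (distr M borel (\<lambda>\<omega>. exp (W \<omega>))) E = \<dots>" .
qed (simp add: ray_arclength_def)

section \<open>The exit point of the wedge\<close>

text \<open>
  Two continuous arguments differ by a continuous function with values in \<open>2 * pi * \<int>\<close> that vanishes at \<open>0\<close>.
\<close>

lemma path_arg_eq_Im_log_path:
  assumes L: "is_log_path \<gamma> L" and t: "0 \<le> t"
  shows "path_arg \<gamma> t = Im (L t)"
proof -
  have L': "continuous_on {0..} L" "L 0 = 0" "\<And>t. 0 \<le> t \<Longrightarrow> exp (L t) = \<gamma> t"
    using L by (auto simp: is_log_path_def)
  have arg: "is_Arg (\<gamma> t) (Im (L t))" "\<gamma> t \<noteq> 0" if "0 \<le> t" for t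
  proof -
    have "norm (\<gamma> t) = exp (Re (L t))" "\<gamma> t = of_real (exp (Re (L t))) * exp (\<i> * of_real (Im (L t)))"
      unfolding L'(3)[OF that, symmetric] cis_conv_exp[symmetric] by (rule norm_exp_eq_Re exp_eq_polar)+
    thus "is_Arg (\<gamma> t) (Im (L t))" "\<gamma> t \<noteq> 0" by (auto simp: is_Arg_def)
  qed
  have "continuous_arg_of \<gamma> (\<lambda>t. Im (L t))"
    unfolding continuous_arg_of_def using L'(1,2) arg by (auto intro!: continuous_intros)
  hence c: "continuous_arg_of \<gamma> (path_arg \<gamma>)"
    unfolding path_arg_def by (rule someI[of "continuous_arg_of \<gamma>"])
  define d where "d t = \<bar>path_arg \<gamma> t - Im (L t)\<bar>" for t
  have d_cont: "continuous_on {0..} d"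
    unfolding d_def using c L'(1) by (intro continuous_intros) (auto simp: continuous_arg_of_def)
  have d_gap: "d t = 0" if "0 \<le> t" "d t < 2 * pi" for t
    using is_Arg_eqI[of "\<gamma> t" "path_arg \<gamma> t" "Im (L t)"] that arg[of t] c
    by (auto simp: d_def continuous_arg_of_def)
  have "d t < 2 * pi"
  proof (rule ccontr)
    assume *: "\<not> d t < 2 * pi"
    have "d 0 = 0" using c L'(2) by (simp add: d_def continuous_arg_of_def)
    moreover have "pi \<le> d t" using * pi_gt_zero by linarith
    ultimately have "\<exists>s\<ge>0. s \<le> t \<and> d s = pi"
      using t by (intro IVT' continuous_on_subset[OF d_cont]) auto
    then obtain s where "0 \<le> s" "d s = pi" by blast
    thus False using d_gap[of s] pi_gt_zero by auto
  qed
  thus ?thesis using d_gap[OF t] by (simp add: d_def)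
qed

lemma wedge_exit_point_eq:
  assumes L: "is_log_path \<gamma> L" and \<tau>: "0 \<le> \<tau>" "Im (L \<tau>) \<in> {- r2 * pi, r1 * pi}"
    and before: "\<And>t. 0 \<le> t \<Longrightarrow> t < \<tau> \<Longrightarrow> L t \<in> log_strip (- r2 * pi) (r1 * pi)"
  shows "wedge_exit_point r1 r2 \<gamma> = exp (L \<tau>)"
proof -
  define H where "H = {t. 0 \<le> t \<and> (path_arg \<gamma> t = r1 * pi \<or> path_arg \<gamma> t = - r2 * pi)}"
  have arg: "path_arg \<gamma> t = Im (L t)" if "0 \<le> t" for t by (rule path_arg_eq_Im_log_path[OF L that])
  have "\<tau> \<in> H" using \<tau> arg[of \<tau>] by (auto simp: H_def)
  moreover have "\<tau> \<le> t" if "t \<in> H" for t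
    using that before[of t] arg[of t] by (force simp: H_def log_strip_def)
  ultimately have "Inf (ereal ` H) = ereal \<tau>"
    by (intro Inf_eqI) auto
  hence "wedge_exit_time r1 r2 \<gamma> = ereal \<tau>" by (simp add: wedge_exit_time_def H_def)
  thus ?thesis using L \<tau>(1) by (simp add: wedge_exit_point_def is_log_path_def)
qed

text \<open>
  The exit point is defined through a choice of argument for each path and agrees only almost surely with a
  measurable variable; this is why the completed measure appears.
\<close>

lemma (in planar_brownian_motion) distributed_wedge_exit_point:
  assumes z: "z = 1" and r: "0 < r1" "0 < r2"
  shows "distributed (completion M) (ray_arclength {cis (r1 * pi), cis (- r2 * pi)})
    (\<lambda>\<omega>. wedge_exit_point r1 r2 (\<lambda>t. B t \<omega>))
    (exit_density (cis (r1 * pi)) (cis (- r2 * pi)) (p_plus r1 r2) (p_minus r1 r2))"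
proof -
  let ?X = "\<lambda>\<omega>. wedge_exit_point r1 r2 (\<lambda>t. B t \<omega>)"
  let ?U = "{cis (r1 * pi), cis (- r2 * pi)}"
  have ab: "- r2 * pi < 0" "0 < r1 * pi" using r by auto
  obtain W where W: "W \<in> borel_measurable M"
    "AE \<omega> in M. Im (W \<omega>) \<in> {- r2 * pi, r1 * pi} \<and> is_first_exit_value (log_strip (- r2 * pi) (r1 * pi)) (bm_log \<omega>) (W \<omega>)"
    "\<And>a. prob {\<omega> \<in> space M. Re (halfplane_map (- r2 * pi) (r1 * pi) (W \<omega>)) \<le> a} =
        1 / 2 + arctan ((a - - sin (exit_theta r1 r2)) / cos (exit_theta r1 r2)) / pi"
    "\<And>a. prob {\<omega> \<in> space M. a \<le> Re (halfplane_map (- r2 * pi) (r1 * pi) (W \<omega>))} =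
        1 / 2 - arctan ((a - - sin (exit_theta r1 r2)) / cos (exit_theta r1 r2)) / pi"
    using exit_log_tails[OF z ab, unfolded halfplane_map_0[OF r]] by blast
  define Z where "Z \<omega> = exp (W \<omega>)" for \<omega>
  have [measurable]: "exp \<in> borel_measurable (borel :: complex measure)"
    by (intro borel_measurable_continuous_onI continuous_intros)
  have Z: "Z \<in> borel_measurable M" unfolding Z_def using W(1) by measurable
  have law: "distr M borel Z = density (ray_arclength ?U)
      (exit_density (cis (r1 * pi)) (cis (- r2 * pi)) (p_plus r1 r2) (p_minus r1 r2))"
    unfolding Z_def
    by (rule exit_law[OF r W(1)]) (use W(2-4) in \<open>auto elim: eventually_mono\<close>)
  have "AE \<omega> in M. ?X \<omega> = Z \<omega>"
    using W(2) AE_is_log_path[OF z]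
  proof eventually_elim
    case (elim \<omega>)
    then obtain \<tau> where \<tau>: "0 \<le> \<tau>" "W \<omega> = bm_log \<omega> \<tau>"
      "\<And>t. 0 \<le> t \<Longrightarrow> t < \<tau> \<Longrightarrow> bm_log \<omega> t \<in> log_strip (- r2 * pi) (r1 * pi)"
      unfolding is_first_exit_value_def by blast
    show ?case unfolding Z_def \<tau>(2)
      by (rule wedge_exit_point_eq[OF elim(2) \<tau>(1) _ \<tau>(3)]) (use elim(1) \<tau>(2) in auto)
  qed
  hence ae: "AE \<omega> in completion M. ?X \<omega> = Z \<omega>" by (rule AE_completion)
  have Zc: "Z \<in> borel_measurable (completion M)" by (rule measurable_completion[OF Z])
  have Xc: "?X \<in> borel_measurable (completion M)"
  proof (rule measurableI)
    fix E :: "complex set" assume E: "E \<in> sets borel"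
    show "?X -` E \<inter> space (completion M) \<in> sets (completion M)"
    proof (rule complete_measure.in_sets_AE[OF completion.complete_measure_axioms])
      show "Z -` E \<inter> space (completion M) \<in> sets (completion M)" by (rule measurable_sets[OF Zc E])
      show "AE \<omega> in completion M. (\<omega> \<in> Z -` E \<inter> space (completion M)) = (\<omega> \<in> ?X -` E \<inter> space (completion M))"
        using ae by eventually_elim auto
    qed auto
  qed auto
  have sets_ray: "sets (ray_arclength ?U) = sets borel" by (simp add: ray_arclength_def)
  have "distr (completion M) (ray_arclength ?U) ?X = distr (completion M) borel Z"
    by (rule distr_cong_AE) (use ae Xc Zc sets_ray in \<open>auto cong: measurable_cong_sets\<close>)
  also have "\<dots> = distr M borel Z" by (rule distr_completion[OF Z])
  finally have "distr (completion M) (ray_arclength ?U) ?X = density (ray_arclength ?U)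
      (exit_density (cis (r1 * pi)) (cis (- r2 * pi)) (p_plus r1 r2) (p_minus r1 r2))"
    unfolding law .
  moreover have "p_plus r1 r2 \<in> borel_measurable borel" "p_minus r1 r2 \<in> borel_measurable borel"
    unfolding p_plus_def[abs_def] p_minus_def[abs_def] Let_def by measurable
  hence "exit_density (cis (r1 * pi)) (cis (- r2 * pi)) (p_plus r1 r2) (p_minus r1 r2) \<in> borel_measurable (ray_arclength ?U)"
    using measurable_cong_sets[OF sets_ray refl] measurable_exit_density by blast
  moreover have "?X \<in> measurable (completion M) (ray_arclength ?U)"
    using Xc measurable_cong_sets[OF refl sets_ray] by blast
  ultimately show ?thesis unfolding distributed_def by blast
qed

theorem mainTheorem13:
  fixes M :: "'w measure" and B :: "real \<Rightarrow> 'w \<Rightarrow> complex" and r1 r2 :: real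
  assumes "0 < r1" and "0 < r2"
    and "planar_brownian_motion M B 1"
  shows "(cis (r1 * pi) \<noteq> cis (- r2 * pi) \<longrightarrow>
           (\<exists>f. distributed (completion M) (ray_arclength {cis (r1 * pi), cis (- r2 * pi)})
                  (\<lambda>\<omega>. wedge_exit_point r1 r2 (\<lambda>t. B t \<omega>)) f \<and>
                (\<forall>y>0. f (y *\<^sub>R cis (r1 * pi)) = ennreal (p_plus r1 r2 y) \<and>
                        f (y *\<^sub>R cis (- r2 * pi)) = ennreal (p_minus r1 r2 y)))) \<and>
         (cis (r1 * pi) = cis (- r2 * pi) \<longrightarrow>
           (\<exists>f. distributed (completion M) (ray_arclength {cis (r1 * pi)})
                  (\<lambda>\<omega>. wedge_exit_point r1 r2 (\<lambda>t. B t \<omega>)) f \<and>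
                (\<forall>y>0. f (y *\<^sub>R cis (r1 * pi)) =
                        ennreal (p_plus r1 r2 y + p_minus r1 r2 y))))"
proof -
  interpret planar_brownian_motion M B 1 by fact
  let ?f = "exit_density (cis (r1 * pi)) (cis (- r2 * pi)) (p_plus r1 r2) (p_minus r1 r2)"
  note D = distributed_wedge_exit_point[OF refl assms(1,2)]
  have f: "?f (y *\<^sub>R w) = (if w = cis (r1 * pi) then ennreal (p_plus r1 r2 y) else 0) +
      (if w = cis (- r2 * pi) then ennreal (p_minus r1 r2 y) else 0)" if "0 < y" "norm w = 1" for y w
    by (rule exit_density_on_ray[OF that(1) _ _ that(2)]) auto
  have nonneg: "0 \<le> p_plus r1 r2 y" "0 \<le> p_minus r1 r2 y" for y
    using assms cos_exit_theta_pos[OF assms(1,2)] by (auto simp: p_plus_def p_minus_def Let_def)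
  show ?thesis
  proof (intro conjI impI)
    assume "cis (r1 * pi) \<noteq> cis (- r2 * pi)"
    thus "\<exists>f. distributed (completion M) (ray_arclength {cis (r1 * pi), cis (- r2 * pi)})
                  (\<lambda>\<omega>. wedge_exit_point r1 r2 (\<lambda>t. B t \<omega>)) f \<and>
                (\<forall>y>0. f (y *\<^sub>R cis (r1 * pi)) = ennreal (p_plus r1 r2 y) \<and>
                        f (y *\<^sub>R cis (- r2 * pi)) = ennreal (p_minus r1 r2 y))"
      using D f by (intro exI[of _ ?f]) auto
  next
    assume eq: "cis (r1 * pi) = cis (- r2 * pi)"
    show "\<exists>f. distributed (completion M) (ray_arclength {cis (r1 * pi)})
                  (\<lambda>\<omega>. wedge_exit_point r1 r2 (\<lambda>t. B t \<omega>)) f \<and>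
                (\<forall>y>0. f (y *\<^sub>R cis (r1 * pi)) = ennreal (p_plus r1 r2 y + p_minus r1 r2 y))"
    proof (intro exI[of _ ?f] conjI allI impI)
      show "distributed (completion M) (ray_arclength {cis (r1 * pi)})
          (\<lambda>\<omega>. wedge_exit_point r1 r2 (\<lambda>t. B t \<omega>)) ?f"
        using D unfolding eq by (simp only: insert_absorb2)
      show "?f (y *\<^sub>R cis (r1 * pi)) = ennreal (p_plus r1 r2 y + p_minus r1 r2 y)" if "0 < y" for y
        unfolding f[OF that norm_cis] if_P[OF refl] if_P[OF eq] by (rule ennreal_plus[OF nonneg, symmetric])
    qed
  qed
qed

end
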